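(* Let $D\subseteq[n]\times[n]$ be a diagram that is multiplicity-free. Then the dual character $\chi_D(x)$ of the flagged Weyl module $\mathcal{M}_D$ is zero-one, i.e. every coefficient of every monomial in $\chi_D(x)\in\mathbb{Z}[x_1,\ldots,x_n]$ is equal to $0$ or $1$.
   Context: A diagram is a subset $D$ of the grid $[n]\times[n]$; $(i,j)$ denotes the position in row $i$ and column $j$ (matrix coordinates, row $1$ at the top). Write $D=(D_1,\ldots,D_n)$ where $D_j=\{i:(i,j)\in D\}\subseteq[n]$. A position $(i,j)\notin D$ is called a crossing. Multiplicity-free: $D$ is called multiplicitous if there exist row indices $i_1<i_2<i_3<i_4$ in $[n]$ and two distinct columns $c_1\neq c_2$ of $[n]$ (in either order) such that the restriction of $D$ to rows $i_1,i_2,i_3,i_4$ and columns $c_1,c_2$ matches one of the following six configurations. Each configuration lists, for rows $i_1,i_2,i_3,i_4$ from top to bottom, a pair (status at column $c_1$, status at column $c_2$), where "$\square$" means the position belongs to $D$, "$\times$" means it does not, and "$*$" means no restriction: (A) $(\times,\times),(\square,\times),( *,\square),( *,* )$; (B) $(\times,\square),(\times,\times),(\square,\square),(\square,* )$; (C) $(\times,\times),(\times,\times),(\square,\square),(\square,* )$; (D) $(\times,\square),(\square,\times),(\square,\square),( *,* )$; (E) $(\times,\square),(\square,\times),(\square,\times),(\times,\square)$; (F) $(\square,\times),(\times,\square),(\square,\times),(\times,\square)$. (Allowing $c_1>c_2$ means each configuration may also appear with its two columns swapped.) $D$ is multiplicity-free if it is not multiplicitous. Flagged Weyl module: For $k$-subsets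 $R=\{r_1<\cdots<r_k\}$, $S=\{s_1<\cdots<s_k\}$ of $[n]$ write $R\le S$ (Gale order) if $r_i\le s_i$ for all $i$. For diagrams $C=(C_1,\ldots,C_n)$, $D=(D_1,\ldots,D_n)$ write $C\le D$ if $|C_j|=|D_j|$ and $C_j\le D_j$ for all $j$. Let $Y$ be the $n\times n$ upper-triangular matrix with entries the indeterminates $y_{ij}$ ($i\le j$) and zeros below the diagonal; $Y^R_S$ is its submatrix with rows $R$ and columns $S$. For $C\le D$ put $\det(Y^C_D)=\prod_{j=1}^n\det(Y^{C_j}_{D_j})$ (an empty determinant is $1$). Let $B\subseteq\mathrm{GL}(n,\mathbb{C})$ be the group of invertible upper-triangular matrices, acting on $\mathbb{C}[y_{ij}:i\le j]$ by $(f\cdot b)(Y)=f(b^{-1}Y)$. The flagged Weyl module is $\mathcal{M}_D=\mathrm{Span}_{\mathbb{C}}\{\det(Y^C_D):C\le D\}$, a $B$-module. Its character is $\mathrm{char}(\mathcal{M}_D)(x_1,\ldots,x_n)=\mathrm{tr}(X:\mathcal{M}_D\to\mathcal{M}_D)$ with $X=\mathrm{diag}(x_1,\ldots,x_n)$, and the dual character is $\chi_D(x)=\mathrm{char}(\mathcal{M}_D)(x_1^{-1},\ldots,x_n^{-1})$. Equivalently, the coefficient of $x^a$ in $\chi_D(x)$ equals $\dim\mathrm{Span}_{\mathbb{C}}\{\det(Y^C_D):C\le D,\ x^C=x^a\}$, where $x^C=\prod_j\prod_{i\in C_j}x_i$.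
   Formalization: In the definition of multiplicitous, row i_4 may lie below the grid (i_4 > n), which matters only for (A) and (D); with i_4 required in [n] the claim fails, e.g. n=3, D={(2,1),(3,2)} gives (x1+x2)(x1+x2+x3), which has a coefficient 2. *)

theory Defs
  imports
    Complex_Main
    "HOL-Library.Poly_Mapping"
    "Jordan_Normal_Form.Determinant"
    "Jordan_Normal_Form.Gauss_Jordan_Elimination"
    "Jordan_Normal_Form.DL_Submatrix"
begin

text \<open>Rows, columns and variables are numbered from 0, so that \<open>[n]\<close> is \<open>{..<n}\<close>, as in the matrix
  library.\<close>

section \<open>Polynomials in commuting variables\<close>

type_synonym ('v, 'a) mpoly = "('v \<Rightarrow>\<^sub>0 nat) \<Rightarrow>\<^sub>0 'a"

definition mconst :: "'a \<Rightarrow> ('v, 'a::zero) mpoly" where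
  "mconst c = Poly_Mapping.single 0 c"

definition mvar :: "'v \<Rightarrow> ('v, 'a::zero_neq_one) mpoly" where
  "mvar v = Poly_Mapping.single (Poly_Mapping.single v 1) 1"

text \<open>Substitution of \<open>\<sigma> v\<close> for each variable \<open>v\<close>, with coefficients mapped along \<open>h\<close>.\<close>

definition meval :: "('a::zero \<Rightarrow> 'b::comm_semiring_1) \<Rightarrow> ('v \<Rightarrow> 'b) \<Rightarrow> ('v, 'a) mpoly \<Rightarrow> 'b" where
  "meval h \<sigma> p = (\<Sum>m\<in>Poly_Mapping.keys p. h (Poly_Mapping.lookup p m) *
     (\<Prod>v\<in>Poly_Mapping.keys m. \<sigma> v ^ Poly_Mapping.lookup m v))"

definition mvars :: "('v, 'a::zero) mpoly \<Rightarrow> 'v set" where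
  "mvars p = (\<Union>m\<in>Poly_Mapping.keys p. Poly_Mapping.keys m)"

type_synonym ypoly = "(nat \<times> nat, complex) mpoly"

global_interpretation yvs: vector_space "\<lambda>c (p::ypoly). mconst c * p"
  by unfold_locales
    (simp_all add: mconst_def distrib_left distrib_right single_add mult_single
      mult.assoc[symmetric])

text \<open>Trace of an endomorphism \<open>f\<close> of a finite-dimensional subspace \<open>V\<close>: the sum of the diagonal
  entries of its matrix in some basis of \<open>V\<close> (the choice is immaterial).\<close>

definition trace_on :: "ypoly set \<Rightarrow> (ypoly \<Rightarrow> ypoly) \<Rightarrow> complex" where
  "trace_on V f =
     (let B = (SOME B. yvs.independent B \<and> yvs.span B = V)
      in \<Sum>b\<in>B. yvs.representation B (f b) b)"

section \<open>Diagrams\<close>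

type_synonym diagram = "(nat \<times> nat) set"

definition is_diagram :: "nat \<Rightarrow> diagram \<Rightarrow> bool" where
  "is_diagram n D \<longleftrightarrow> D \<subseteq> {..<n} \<times> {..<n}"

definition dcol :: "diagram \<Rightarrow> nat \<Rightarrow> nat set" where
  "dcol D j = {i. (i, j) \<in> D}"

datatype status = Box | Cross | Any

fun has_status :: "diagram \<Rightarrow> nat \<times> nat \<Rightarrow> status \<Rightarrow> bool" where
  "has_status D p Box \<longleftrightarrow> p \<in> D"
| "has_status D p Cross \<longleftrightarrow> p \<notin> D"
| "has_status D p Any \<longleftrightarrow> True"

definition configurations :: "(status \<times> status) list set" where
  "configurations =
    {[(Cross, Cross), (Box, Cross), (Any, Box), (Any, Any)],
     [(Cross, Box), (Cross, Cross), (Box, Box), (Box, Any)],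
     [(Cross, Cross), (Cross, Cross), (Box, Box), (Box, Any)],
     [(Cross, Box), (Box, Cross), (Box, Box), (Any, Any)],
     [(Cross, Box), (Box, Cross), (Box, Cross), (Cross, Box)],
     [(Box, Cross), (Cross, Box), (Box, Cross), (Cross, Box)]}"

text \<open>The fourth row is not required to lie in the grid. For a diagram in \<open>[n] \<times> [n]\<close> this matters
  only for the first and fourth configurations: every other one forces a box in its fourth row, and
  these two impose nothing on it, while a box in their third row keeps the first three rows in the
  grid. Requiring \<open>i4 < n\<close> would make the properties of the diagram depend on whether an
  empty row is added below it, and zero-oneness would fail: for \<open>n = 3\<close> and boxes in (one-based)
  positions \<open>(2,1)\<close> and \<open>(3,2)\<close>, the dual character is \<open>(x1 + x2) * (x1 + x2 + x3)\<close>. Equivalently,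
  the diagram is regarded as lying in \<open>[n+1] \<times> [n+1]\<close>, which does not change its dual
  character.\<close>

definition multiplicitous :: "nat \<Rightarrow> diagram \<Rightarrow> bool" where
  "multiplicitous n D \<longleftrightarrow>
     (\<exists>i1 i2 i3 i4 c1 c2. i1 < i2 \<and> i2 < i3 \<and> i3 < i4 \<and> i3 < n \<and>
        c1 < n \<and> c2 < n \<and> c1 \<noteq> c2 \<and>
        (\<exists>P\<in>configurations.
           list_all2 (\<lambda>i (s, t). has_status D (i, c1) s \<and> has_status D (i, c2) t)
             [i1, i2, i3, i4] P))"

definition multiplicity_free :: "nat \<Rightarrow> diagram \<Rightarrow> bool" where
  "multiplicity_free n D \<longleftrightarrow> \<not> multiplicitous n D"

definition gale_le :: "nat set \<Rightarrow> nat set \<Rightarrow> bool" where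
  "gale_le R S \<longleftrightarrow> list_all2 (\<le>) (sorted_list_of_set R) (sorted_list_of_set S)"

definition diagram_le :: "nat \<Rightarrow> diagram \<Rightarrow> diagram \<Rightarrow> bool" where
  "diagram_le n C D \<longleftrightarrow>
     (\<forall>j<n. card (dcol C j) = card (dcol D j) \<and> gale_le (dcol C j) (dcol D j))"

section \<open>Flagged Weyl modules\<close>

definition Ymat :: "nat \<Rightarrow> ypoly mat" where
  "Ymat n = mat n n (\<lambda>(i, j). if i \<le> j then mvar (i, j) else 0)"

definition diagram_det :: "nat \<Rightarrow> diagram \<Rightarrow> diagram \<Rightarrow> ypoly" where
  "diagram_det n C D = (\<Prod>j<n. det (submatrix (Ymat n) (dcol C j) (dcol D j)))"

definition flagged_weyl :: "nat \<Rightarrow> diagram \<Rightarrow> ypoly set" where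
  "flagged_weyl n D = yvs.span {diagram_det n C D | C. is_diagram n C \<and> diagram_le n C D}"

text \<open>\<open>(f \<cdot> b)(Y) = f(b\<^sup>-\<^sup>1 Y)\<close> for invertible upper-triangular \<open>b\<close> and \<open>f\<close> a polynomial in
  the entries of \<open>Ymat n\<close>; outside of this domain the value is arbitrary.\<close>

definition borel_act :: "nat \<Rightarrow> complex mat \<Rightarrow> ypoly \<Rightarrow> ypoly" where
  "borel_act n b f =
     meval mconst (\<lambda>ij. (map_mat mconst (the (mat_inverse b)) * Ymat n) $$ ij) f"

definition weyl_char :: "nat \<Rightarrow> diagram \<Rightarrow> (nat \<Rightarrow> complex) \<Rightarrow> complex" where
  "weyl_char n D x = trace_on (flagged_weyl n D) (borel_act n (mat_diag n x))"

definition dual_char :: "nat \<Rightarrow> diagram \<Rightarrow> (nat \<Rightarrow> complex) \<Rightarrow> complex" where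
  "dual_char n D x = weyl_char n D (\<lambda>i. inverse (x i))"

text \<open>\<open>p\<close> is the expression of \<open>F\<close>, a function on the torus of invertible diagonal matrices, as an
  element of \<open>\<int>[x\<^sub>0, \<dots>, x\<^sub>n\<^sub>-\<^sub>1]\<close>. There is at most one such \<open>p\<close>, since a polynomial that vanishes on
  the torus is zero.\<close>

definition represents_on_torus ::
    "nat \<Rightarrow> (nat, int) mpoly \<Rightarrow> ((nat \<Rightarrow> complex) \<Rightarrow> complex) \<Rightarrow> bool" where
  "represents_on_torus n p F \<longleftrightarrow> mvars p \<subseteq> {..<n} \<and>
     (\<forall>x. (\<forall>i<n. x i \<noteq> 0) \<longrightarrow> F x = meval of_int x p)"

end

theory Submission
  imports Defs "HOL-Library.Product_Lexorder"
begin

text \<open>A weight space of the flagged Weyl module is spanned by the determinants \<open>det(Y\<^sup>C\<^sub>D)\<close> of one weight, so it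
  suffices that for multiplicity-free \<open>D\<close> the polynomial \<open>det(Y\<^sup>C\<^sub>D)\<close> depends only on the row weight of
  \<open>C\<close>. As \<open>Y\<close> is upper triangular, a minor factors at \<open>t\<close> as soon as its row and column sets
  have equally many elements at or beyond \<open>t\<close>. If in some interval of rows (a window) two columns of \<open>D\<close>
  agree, and the minors of both columns factor at both ends of it, then exchanging the parts of
  the two columns of \<open>C\<close> inside the window changes neither the weight nor the product of the minors.
  Let \<open>C\<close> and \<open>C'\<close> have the same weight and let \<open>r\<close> be the first row where they differ. Then some
  column has a box in row \<open>r\<close> only in \<open>C\<close>, and another one only in \<open>C'\<close>. For these two
  columns the forbidden configurations leave so few possibilities that a window exists in
  \<open>C\<close> or in \<open>C'\<close> whose exchange repairs both disagreements in row \<open>r\<close> and touches no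
  earlier row. Iterating turns \<open>C\<close> and \<open>C'\<close> into the same diagram.\<close>

section \<open>The Gale order\<close>

text \<open>Tail counts are additive over intervals, unlike the comparison of sorted lists, so this
  form of the Gale order can be followed through changes inside an interval.\<close>

definition dominated :: "nat set \<Rightarrow> nat set \<Rightarrow> bool" where
  "dominated A S \<longleftrightarrow> finite A \<and> finite S \<and> card A = card S \<and>
     (\<forall>t. card (A \<inter> {t..}) \<le> card (S \<inter> {t..}))"

lemma list_all2_le_filter_length:
  fixes xs ys :: "nat list"
  assumes "list_all2 (\<le>) xs ys"
  shows "length (filter (\<lambda>x. t \<le> x) xs) \<le> length (filter (\<lambda>x. t \<le> x) ys)"
  using assms by (induction rule: list_all2_induct) auto

text \<open>The threshold \<open>x\<close> forces \<open>x \<le> y\<close>, since it keeps all of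
  \<open>x # xs\<close>. For the tails, a threshold up to \<open>y\<close> keeps all of
  \<open>ys\<close>, and a larger one does not count \<open>y\<close>.\<close>

lemma list_all2_le_if_filter_length:
  fixes xs ys :: "nat list"
  assumes "sorted xs" "sorted ys" "length xs = length ys"
    and "\<And>t. length (filter (\<lambda>x. t \<le> x) xs) \<le> length (filter (\<lambda>x. t \<le> x) ys)"
  shows "list_all2 (\<le>) xs ys"
  using assms(3,1,2,4)
proof (induction rule: list_induct2)
  case Nil
  then show ?case by simp
next
  case (Cons x xs y ys)
  have all: "filter (\<lambda>z. t \<le> z) zs = zs" if "sorted (z # zs)" "t \<le> z" for t z and zs :: "nat list"
    using that by (auto simp: filter_id_conv)
  have "x \<le> y"
  proof (rule ccontr)
    assume "\<not> x \<le> y"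
    then have "length (filter (\<lambda>z. x \<le> z) (y # ys)) \<le> length ys" by simp
    moreover have "length (filter (\<lambda>z. x \<le> z) (x # xs)) = Suc (length xs)"
      using all[of x xs x] Cons.prems by simp
    ultimately show False using Cons.prems(3)[of x] Cons.hyps by simp
  qed
  moreover have "list_all2 (\<le>) xs ys"
  proof (rule Cons.IH)
    fix t
    show "length (filter (\<lambda>x. t \<le> x) xs) \<le> length (filter (\<lambda>x. t \<le> x) ys)"
    proof (cases "t \<le> y")
      case True
      have "length (filter (\<lambda>x. t \<le> x) xs) \<le> length xs" by simp
      then show ?thesis using True all[of y ys t] Cons.prems(1,2) Cons.hyps by simp
    next
      case False
      then show ?thesis using Cons.prems(3)[of t] by (simp split: if_splits)
    qed
  qed (use Cons.prems in auto)
  ultimately show ?case by simp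
qed

lemma gale_le_iff_dominated:
  assumes "finite A" "finite S" "card A = card S"
  shows "gale_le A S \<longleftrightarrow> dominated A S"
proof -
  have len: "length (filter (\<lambda>x. t \<le> x) (sorted_list_of_set X)) = card (X \<inter> {t..})"
    if "finite X" for X :: "nat set" and t
    using that distinct_card[of "filter (\<lambda>x. t \<le> x) (sorted_list_of_set X)"]
    by (simp add: Int_def atLeast_def)
  show ?thesis
  proof
    assume "gale_le A S"
    from list_all2_le_filter_length[OF this[unfolded gale_le_def]] assms
    show "dominated A S" by (simp add: dominated_def len)
  next
    assume "dominated A S"
    then have "list_all2 (\<le>) (sorted_list_of_set A) (sorted_list_of_set S)"
      by (intro list_all2_le_if_filter_length) (simp_all add: dominated_def len)
    then show "gale_le A S" by (simp add: gale_le_def)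
  qed
qed

lemma card_Int_atLeast_split:
  fixes X :: "nat set"
  assumes "finite X" "a \<le> b"
  shows "card (X \<inter> {a..}) = card (X \<inter> {a..<b}) + card (X \<inter> {b..})"
proof -
  have "X \<inter> {a..} = (X \<inter> {a..<b}) \<union> (X \<inter> {b..})" using assms(2) by auto
  then show ?thesis using assms(1) by (subst card_Un_disjoint[symmetric]) auto
qed

lemma card_lessThan_split:
  fixes X :: "nat set"
  assumes "finite X"
  shows "card X = card (X \<inter> {..<t}) + card (X \<inter> {t..})"
  using card_Int_atLeast_split[OF assms, of 0 t] by (simp add: atLeast0LessThan)

text \<open>Under \<open>dominated A S\<close> this says that the minor with rows \<open>A\<close> and columns \<open>S\<close> is block
  triangular with square diagonal blocks cut at \<open>t\<close>.\<close>

definition splits :: "nat \<Rightarrow> nat set \<Rightarrow> nat set \<Rightarrow> bool" where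
  "splits t A S \<longleftrightarrow> card (A \<inter> {t..}) = card (S \<inter> {t..})"

lemma splits_iff_below:
  assumes "dominated A S"
  shows "splits t A S \<longleftrightarrow> card (A \<inter> {..<t}) = card (S \<inter> {..<t})"
  using assms card_lessThan_split[of A t] card_lessThan_split[of S t]
  unfolding dominated_def splits_def by auto

lemma dominated_below:
  assumes "dominated A S"
  shows "card (S \<inter> {..<t}) \<le> card (A \<inter> {..<t})"
proof -
  have "card (A \<inter> {t..}) \<le> card (S \<inter> {t..})" "card A = card S" "finite A" "finite S"
    using assms by (auto simp: dominated_def)
  then show ?thesis using card_lessThan_split[of A t] card_lessThan_split[of S t] by linarith
qed

section \<open>Exchanging a window\<close>

definition swap_window :: "nat \<Rightarrow> nat \<Rightarrow> nat set \<Rightarrow> nat set \<Rightarrow> nat set" where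
  "swap_window p q A B = (A - {p..<q}) \<union> (B \<inter> {p..<q})"

lemma swap_window_Int:
  "swap_window p q A B \<inter> {p..<q} = B \<inter> {p..<q}"
  "p \<le> q \<Longrightarrow> swap_window p q A B \<inter> {q..} = A \<inter> {q..}"
  "swap_window p q A B \<inter> {..<p} = A \<inter> {..<p}"
  by (auto simp: swap_window_def)

text \<open>The cuts give \<open>A\<close> and \<open>S\<close> equally many elements inside the
  window, and likewise \<open>B\<close> and \<open>T\<close>. As \<open>S\<close> and
  \<open>T\<close> coincide there, the part taken from \<open>B\<close> has the size of the part of
  \<open>A\<close> that it replaces.\<close>

lemma dominated_swap_window:
  assumes AS: "dominated A S" and BT: "dominated B T" and pq: "p \<le> q"
    and W: "S \<inter> {p..<q} = T \<inter> {p..<q}"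
    and sp: "splits p A S" "splits q A S" "splits p B T" "splits q B T"
  shows "dominated (swap_window p q A B) S"
    and "splits p (swap_window p q A B) S" and "splits q (swap_window p q A B) S"
proof -
  let ?X = "swap_window p q A B"
  have fin: "finite A" "finite B" "finite S" "finite T" "finite ?X"
    using AS BT by (auto simp: dominated_def swap_window_def)
  have cB: "card (B \<inter> {p..<q}) = card (T \<inter> {p..<q})"
    using sp fin card_Int_atLeast_split[OF fin(2) pq] card_Int_atLeast_split[OF fin(4) pq]
    unfolding splits_def by simp
  have cA: "card (A \<inter> {p..<q}) = card (S \<inter> {p..<q})"
    using sp fin card_Int_atLeast_split[OF fin(1) pq] card_Int_atLeast_split[OF fin(3) pq]
    unfolding splits_def by simp
  have q: "card (?X \<inter> {q..}) = card (A \<inter> {q..})" using swap_window_Int pq by simp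
  have p: "card (?X \<inter> {p..}) = card (A \<inter> {p..})"
    using card_Int_atLeast_split[OF fin(1) pq] card_Int_atLeast_split[OF fin(5) pq] q
      swap_window_Int(1)[of p q A B] cA cB W by simp
  have above: "card (?X \<inter> {t..}) \<le> card (S \<inter> {t..})" for t
  proof -
    consider "q \<le> t" | "p \<le> t" "t < q" | "t < p" by linarith
    then show ?thesis
    proof cases
      case 1
      then have "?X \<inter> {t..} = A \<inter> {t..}" by (auto simp: swap_window_def)
      then show ?thesis using AS by (simp add: dominated_def)
    next
      \<comment> \<open>Beyond \<open>q\<close> both pairs are balanced, so the bound of
        \<open>B\<close> by \<open>T\<close> restricts to \<open>{t..<q}\<close>, where
        \<open>S\<close> may stand for \<open>T\<close>.\<close>
      case 2
      then have tq: "t \<le> q" by simp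
      have "?X \<inter> {t..<q} = B \<inter> {t..<q}" using 2 by (auto simp: swap_window_def)
      moreover have "S \<inter> {t..<q} = T \<inter> {t..<q}"
        using arg_cong[OF W, of "\<lambda>X. X \<inter> {t..<q}"] 2 by (simp add: Int_assoc)
      moreover have "card (B \<inter> {t..}) \<le> card (T \<inter> {t..})" using BT by (simp add: dominated_def)
      ultimately show ?thesis
        using card_Int_atLeast_split[OF fin(5) tq] card_Int_atLeast_split[OF fin(2) tq]
          card_Int_atLeast_split[OF fin(4) tq] card_Int_atLeast_split[OF fin(3) tq] sp q
        unfolding splits_def by simp
    next
      case 3
      then have tp: "t \<le> p" by simp
      have "?X \<inter> {t..<p} = A \<inter> {t..<p}" by (auto simp: swap_window_def)
      then have "card (?X \<inter> {t..}) = card (A \<inter> {t..})"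
        using card_Int_atLeast_split[OF fin(5) tp] card_Int_atLeast_split[OF fin(1) tp] p by simp
      then show ?thesis using AS by (simp add: dominated_def)
    qed
  qed
  have "card ?X = card A"
    using card_lessThan_split[OF fin(5), of p] card_lessThan_split[OF fin(1), of p] p
      swap_window_Int(3)[of p q A B] by simp
  then show "dominated ?X S" using above AS fin by (simp add: dominated_def)
  show "splits p ?X S" "splits q ?X S" using sp p q by (simp_all add: splits_def)
qed

text \<open>The six forbidden configurations, for two columns in this order. The fourth row is unbounded,
  so the first and fourth configuration drop it.\<close>

definition free_pair :: "nat set \<Rightarrow> nat set \<Rightarrow> bool" where
  "free_pair S T \<longleftrightarrow> (\<forall>i1 i2 i3 i4. i1 < i2 \<longrightarrow> i2 < i3 \<longrightarrow> i3 < i4 \<longrightarrow>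
     \<not> (i1 \<notin> S \<and> i1 \<notin> T \<and> i2 \<in> S \<and> i2 \<notin> T \<and> i3 \<in> T) \<and>
     \<not> (i1 \<notin> S \<and> i1 \<in> T \<and> i2 \<notin> S \<and> i2 \<notin> T \<and> i3 \<in> S \<and> i3 \<in> T \<and> i4 \<in> S) \<and>
     \<not> (i1 \<notin> S \<and> i1 \<notin> T \<and> i2 \<notin> S \<and> i2 \<notin> T \<and> i3 \<in> S \<and> i3 \<in> T \<and> i4 \<in> S) \<and>
     \<not> (i1 \<notin> S \<and> i1 \<in> T \<and> i2 \<in> S \<and> i2 \<notin> T \<and> i3 \<in> S \<and> i3 \<in> T) \<and>
     \<not> (i1 \<notin> S \<and> i1 \<in> T \<and> i2 \<in> S \<and> i2 \<notin> T \<and> i3 \<in> S \<and> i3 \<notin> T \<and> i4 \<notin> S \<and> i4 \<in> T) \<and>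
     \<not> (i1 \<in> S \<and> i1 \<notin> T \<and> i2 \<notin> S \<and> i2 \<in> T \<and> i3 \<in> S \<and> i3 \<notin> T \<and> i4 \<notin> S \<and> i4 \<in> T))"

lemma free_pairD:
  assumes "free_pair S T" "i1 < i2" "i2 < i3"
  shows "\<not> (i1 \<notin> S \<and> i1 \<notin> T \<and> i2 \<in> S \<and> i2 \<notin> T \<and> i3 \<in> T)" (is ?G1)
    and "i3 < i4 \<Longrightarrow> \<not> (i1 \<notin> S \<and> i1 \<in> T \<and> i2 \<notin> S \<and> i2 \<notin> T \<and> i3 \<in> S \<and> i3 \<in> T \<and> i4 \<in> S)" (is "_ \<Longrightarrow> ?G2")
    and "i3 < i4 \<Longrightarrow> \<not> (i1 \<notin> S \<and> i1 \<notin> T \<and> i2 \<notin> S \<and> i2 \<notin> T \<and> i3 \<in> S \<and> i3 \<in> T \<and> i4 \<in> S)" (is "_ \<Longrightarrow> ?G3")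
    and "\<not> (i1 \<notin> S \<and> i1 \<in> T \<and> i2 \<in> S \<and> i2 \<notin> T \<and> i3 \<in> S \<and> i3 \<in> T)" (is ?G4)
    and "i3 < i4 \<Longrightarrow>
      \<not> (i1 \<notin> S \<and> i1 \<in> T \<and> i2 \<in> S \<and> i2 \<notin> T \<and> i3 \<in> S \<and> i3 \<notin> T \<and> i4 \<notin> S \<and> i4 \<in> T)" (is "_ \<Longrightarrow> ?G5")
    and "i3 < i4 \<Longrightarrow>
      \<not> (i1 \<in> S \<and> i1 \<notin> T \<and> i2 \<notin> S \<and> i2 \<in> T \<and> i3 \<in> S \<and> i3 \<notin> T \<and> i4 \<notin> S \<and> i4 \<in> T)" (is "_ \<Longrightarrow> ?G6")
proof -
  note f = assms(1)[unfolded free_pair_def, rule_format, OF assms(2,3)]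
  note g = f[THEN conjunct1] f[THEN conjunct2, THEN conjunct1]
    f[THEN conjunct2, THEN conjunct2, THEN conjunct1]
    f[THEN conjunct2, THEN conjunct2, THEN conjunct2, THEN conjunct1]
    f[THEN conjunct2, THEN conjunct2, THEN conjunct2, THEN conjunct2, THEN conjunct1]
    f[THEN conjunct2, THEN conjunct2, THEN conjunct2, THEN conjunct2, THEN conjunct2]
  \<comment> \<open>The first and fourth configurations say nothing about \<open>i4\<close>, so
    \<open>Suc i3\<close> serves as the fourth row.\<close>
  show ?G1 by (rule g(1)[OF lessI])
  show ?G4 by (rule g(4)[OF lessI])
  assume i4: "i3 < i4"
  show ?G2 by (rule g(2)[OF i4])
  show ?G3 by (rule g(3)[OF i4])
  show ?G5 by (rule g(5)[OF i4])
  show ?G6 by (rule g(6)[OF i4])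
qed

text \<open>The last conjunct makes the exchange leave the rows before \<open>r\<close> alone; with
  \<open>r\<close> in \<open>A\<close> but not in \<open>B\<close>, the box in row \<open>r\<close>
  then changes its column.\<close>

definition exchange_window ::
    "nat set \<Rightarrow> nat set \<Rightarrow> nat set \<Rightarrow> nat set \<Rightarrow> nat \<Rightarrow> nat \<Rightarrow> nat \<Rightarrow> bool" where
  "exchange_window S T A B r p q \<longleftrightarrow> p \<le> r \<and> r < q \<and> S \<inter> {p..<q} = T \<inter> {p..<q} \<and>
     splits p A S \<and> splits q A S \<and> splits p B T \<and> splits q B T \<and>
     A \<inter> {p..<r} = B \<inter> {p..<r}"

section \<open>What full initial runs and short ends force on a dominated set\<close>

text \<open>Going down in the Gale order only moves elements to smaller rows, so a full initial run
  of \<open>S\<close> stays full in \<open>A\<close>.\<close>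

lemma dominated_initial:
  assumes "dominated A S" "{..<m} \<subseteq> S"
  shows "{..<m} \<subseteq> A" and "t \<le> m \<Longrightarrow> splits t A S"
proof -
  have fin: "finite A" "finite S" using assms(1) by (auto simp: dominated_def)
  have "S \<inter> {..<m} = {..<m}" using assms(2) by auto
  then have "m \<le> card (A \<inter> {..<m})" using dominated_below[OF assms(1), of m] by simp
  then have "A \<inter> {..<m} = {..<m}" by (intro card_seteq) auto
  then show A: "{..<m} \<subseteq> A" by blast
  assume "t \<le> m"
  then have "A \<inter> {..<t} = S \<inter> {..<t}" using A assms(2) by auto
  then show "splits t A S" using splits_iff_below[OF assms(1)] by simp
qed

text \<open>Only one row below \<open>h\<close> is missing from \<open>T\<close>, so
  \<open>B\<close> misses at most one there. As \<open>r\<close> is missing, it is that row and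
  everything else below \<open>h\<close> is forced.\<close>

lemma dominated_hole:
  assumes "dominated B T" "{..<h} - {e} \<subseteq> T" "e \<notin> T" "e < h" "r \<notin> B" "r < h"
  shows "B \<inter> {..<h} = {..<h} - {r}" and "splits h B T"
proof -
  have "T \<inter> {..<h} = {..<h} - {e}" using assms by auto
  then have c: "card (T \<inter> {..<h}) = h - 1" using assms by simp
  then have "h - 1 \<le> card (B \<inter> {..<h})" using dominated_below[OF assms(1), of h] by simp
  moreover have "B \<inter> {..<h} \<subseteq> {..<h} - {r}" using assms by auto
  ultimately show *: "B \<inter> {..<h} = {..<h} - {r}"
    using assms by (intro card_seteq) auto
  then show "splits h B T" using splits_iff_below[OF assms(1)] c assms by simp
qed

lemma dominated_above_empty:
  assumes "dominated A S" "S \<inter> {t..} = {}"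
  shows "A \<inter> {t..} = {}" and "splits t A S"
proof -
  have "card (A \<inter> {t..}) \<le> card (S \<inter> {t..})" "finite A"
    using assms(1) by (simp_all add: dominated_def)
  then show "A \<inter> {t..} = {}" using assms(2) by simp
  then show "splits t A S" using assms by (simp add: splits_def)
qed

text \<open>Both sets have equally many elements from \<open>r\<close> on, so the element
  \<open>r\<close> of \<open>A\<close> must be made up for in \<open>A'\<close> strictly beyond
  \<open>r\<close>. Domination passes this on to \<open>S\<close>.\<close>

lemma dominated_diff_above:
  assumes "dominated A S" "dominated A' S" "\<And>i. i < r \<Longrightarrow> i \<in> A \<longleftrightarrow> i \<in> A'"
    and "r \<in> A" "r \<notin> A'"
  shows "\<exists>x\<in>A'. r < x" and "\<exists>s\<in>S. r < s"
proof -
  have fin: "finite A" "finite A'" "finite S" and c: "card A = card A'"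
    using assms(1,2) by (auto simp: dominated_def)
  have "A \<inter> {..<r} = A' \<inter> {..<r}" using assms(3) by auto
  then have "card (A' \<inter> {r..}) = card (A \<inter> {r..})"
    using c card_lessThan_split[OF fin(1), of r] card_lessThan_split[OF fin(2), of r] by simp
  moreover have "card (A \<inter> {r..}) > 0" using assms(4) fin by (auto simp: card_gt_0_iff)
  moreover have "A' \<inter> {r..} = A' \<inter> {Suc r..}"
    using assms(5) by (auto simp: Suc_le_eq le_less)
  ultimately have pos: "card (A' \<inter> {Suc r..}) > 0" by simp
  then show "\<exists>x\<in>A'. r < x" by (auto simp: card_gt_0_iff Suc_le_eq)
  have "card (A' \<inter> {Suc r..}) \<le> card (S \<inter> {Suc r..})" using assms(2) by (simp add: dominated_def)
  then have "card (S \<inter> {Suc r..}) > 0" using pos by linarith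
  then show "\<exists>s\<in>S. r < s" by (auto simp: card_gt_0_iff Suc_le_eq)
qed

lemma dominated_single:
  assumes "dominated A S" "S \<inter> {p..} = {u}" "x \<in> A" "p \<le> x"
  shows "A \<inter> {p..} = {x}" and "splits p A S" and "x \<le> u"
proof -
  have fin: "finite A" using assms(1) by (simp add: dominated_def)
  have "card (A \<inter> {p..}) \<le> card (S \<inter> {p..})" using assms(1) by (simp add: dominated_def)
  then have "card (A \<inter> {p..}) \<le> card {x}" using assms(2) by simp
  then show *: "A \<inter> {p..} = {x}" using assms fin
    by (intro card_seteq[symmetric]) auto
  then show "splits p A S" using assms by (simp add: splits_def)
  show "x \<le> u"
  proof (rule ccontr)
    assume "\<not> x \<le> u"
    moreover have "S \<inter> {x..} = (S \<inter> {p..}) \<inter> {x..}" using assms(4) by auto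
    ultimately have "S \<inter> {x..} = {}" using assms(2) by simp
    from dominated_above_empty(1)[OF assms(1) this] assms(3) show False by auto
  qed
qed

section \<open>Windows for a pair of columns\<close>

text \<open>From \<open>p\<close> on both columns have only the row \<open>u\<close>, so
  \<open>A\<close> has only \<open>r\<close> and \<open>B\<close> only \<open>z\<close> there, and
  the window covers both tails entirely. The witness \<open>z\<close> is what balances
  \<open>B\<close> at \<open>p\<close>.\<close>

lemma exchange_window_single:
  assumes dom: "dominated A S" "dominated B T"
    and single: "S \<inter> {p..} = {u}" "T \<inter> {p..} = {u}" and "p \<le> r" "r \<in> A"
    and z: "z \<in> B" "r < z"
  shows "exchange_window S T A B r p (Suc u)"
proof -
  have A: "A \<inter> {p..} = {r}" "splits p A S" "r \<le> u"
    using dominated_single[OF dom(1) single(1)] assms by auto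
  have B: "B \<inter> {p..} = {z}" "splits p B T"
    using dominated_single[OF dom(2) single(2), of z] assms by auto
  have e: "S \<inter> {Suc u..} = {}" "T \<inter> {Suc u..} = {}"
  proof -
    have "{Suc u..} = {p..} \<inter> {Suc u..}" using A(3) \<open>p \<le> r\<close> by auto
    then have *: "X \<inter> {Suc u..} = (X \<inter> {p..}) \<inter> {Suc u..}" for X by blast
    show "S \<inter> {Suc u..} = {}" "T \<inter> {Suc u..} = {}"
      unfolding *[of S] *[of T] single by simp_all
  qed
  have "A \<inter> {p..<r} = {}" "B \<inter> {p..<r} = {}" 
  proof -
    have *: "X \<inter> {p..<r} = (X \<inter> {p..}) \<inter> {..<r}" for X by auto
    show "A \<inter> {p..<r} = {}" "B \<inter> {p..<r} = {}"
      unfolding *[of A] *[of B] A(1) B(1) using z by simp_all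
  qed
  moreover have "S \<inter> {p..<Suc u} = T \<inter> {p..<Suc u}"
    using arg_cong[OF single(1)[folded single(2)], of "\<lambda>X. X \<inter> {..<Suc u}"]
    by (simp add: Int_assoc atLeastLessThan_def)
  ultimately show ?thesis unfolding exchange_window_def
    using A B assms(5) dominated_above_empty(2)[OF dom(1) e(1)]
      dominated_above_empty(2)[OF dom(2) e(2)] by simp
qed

lemma Int_atLeast_eq_singletonI:
  fixes f :: nat
  assumes "\<And>x. x \<in> X \<Longrightarrow> g \<le> x \<Longrightarrow> x = f" "f \<in> X" "g \<le> f"
  shows "X \<inter> {g..} = {f}"
proof (rule equalityI)
  show "X \<inter> {g..} \<subseteq> {f}" by (rule subsetI, erule IntE, drule assms(1)) simp_all
qed (use assms(2,3) in simp)

text \<open>The full initial run of \<open>T\<close> reaches past a gap \<open>e\<close> of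
  \<open>S\<close>. The configurations then leave \<open>S\<close> a single box \<open>f\<close>
  from row \<open>g\<close> on, which \<open>T\<close> shares, so the window can start at
  \<open>g\<close>.\<close>

lemma exchange_window_mex_less:
  assumes free: "free_pair S T" "free_pair T S"
    and dom: "dominated A S" "dominated A' S" "dominated B T" "dominated B' T"
    and agree: "\<And>i. i < r \<Longrightarrow> i \<in> A \<longleftrightarrow> i \<in> A'" "\<And>i. i < r \<Longrightarrow> i \<in> B' \<longleftrightarrow> i \<in> B"
    and r: "r \<in> A" "r \<notin> A'" "r \<in> B'" "r \<notin> B"
    and mex: "e \<notin> S" "g \<notin> T" "{..<g} \<subseteq> T" "e < g"
  shows "\<exists>p q. exchange_window S T A B r p q"
proof -
  have "g \<le> r" using dominated_initial(1)[OF dom(3) mex(3)] r(4) by (meson lessThan_iff not_le subsetD)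
  obtain s where s: "s \<in> S" "r < s" using dominated_diff_above(2)[OF dom(1,2) agree(1) r(1,2)] by blast
  obtain t where t: "t \<in> T" "r < t" using dominated_diff_above(2)[OF dom(4,3) agree(2) r(3,4)] by blast
  obtain z where z: "z \<in> B" "r < z" using dominated_diff_above(1)[OF dom(4,3) agree(2) r(3,4)] by blast
  have gs: "g < s" "g < t" using s t \<open>g \<le> r\<close> by auto
  have e: "e \<in> T" using mex by auto
  \<comment> \<open>Otherwise rows \<open>e\<close> and \<open>g\<close> start three configurations:
    the fourth keeps \<open>s\<close> out of \<open>T\<close> and \<open>t\<close> out of
    \<open>S\<close>, and the fifth and the column-swapped sixth exclude both orders of
    \<open>s\<close> and \<open>t\<close>.\<close>
  have gS: "g \<notin> S"
  proof
    assume g: "g \<in> S"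
    have "s \<notin> T" using free_pairD(4)[OF free(1) mex(4) gs(1)] mex e g s by blast
    moreover have "t \<notin> S" using free_pairD(4)[OF free(1) mex(4) gs(2)] mex e g t by blast
    moreover have "\<not> s < t"
      using free_pairD(5)[OF free(1) mex(4) gs(1), of t] mex e g s t calculation by blast
    moreover have "\<not> t < s"
      using free_pairD(6)[OF free(2) mex(4) gs(2), of s] mex e g s t calculation by blast
    ultimately show False using s t by (metis linorder_neqE_nat)
  qed
  \<comment> \<open>\<open>f\<close> is the first occupied row after \<open>g\<close>, which is
    empty in both columns; the first configuration with \<open>g\<close> on top puts it in
    both.\<close>
  define f where "f = (LEAST x. g < x \<and> x \<in> S \<union> T)"
  have f: "g < f" "f \<in> S \<union> T"
    unfolding f_def using LeastI[of "\<lambda>x. g < x \<and> x \<in> S \<union> T" s] gs s by auto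
  have fmin: "f \<le> x" if "g < x" "x \<in> S \<union> T" for x
    unfolding f_def using Least_le[of "\<lambda>x. g < x \<and> x \<in> S \<union> T" x] that by auto
  have fS: "f \<in> S"
  proof (rule ccontr)
    assume "f \<notin> S"
    then have "f < s" using fmin[OF gs(1)] s by (metis UnI1 le_less)
    then show False using free_pairD(1)[OF free(2) f(1), of s] \<open>f \<notin> S\<close> f mex gS s by blast
  qed
  have fT: "f \<in> T"
  proof (rule ccontr)
    assume "f \<notin> T"
    then have "f < t" using fmin[OF gs(2)] t by (metis UnI2 le_less)
    then show False using free_pairD(1)[OF free(1) f(1), of t] \<open>f \<notin> T\<close> f mex gS t by blast
  qed
  \<comment> \<open>A second box of \<open>S\<close> after \<open>f\<close> would complete the
    second configuration on rows \<open>e\<close>, \<open>g\<close>, \<open>f\<close>.\<close>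
  have S: "S \<inter> {g..} = {f}"
  proof -
    have "x = f" if "x \<in> S" "g \<le> x" for x
    proof (rule ccontr)
      assume "x \<noteq> f"
      then have "f < x" using fmin[of x] that gS by (metis UnI1 le_less)
      then show False
        using free_pairD(2)[OF free(1) mex(4) f(1)] mex(1,2) e gS fS fT that by blast
    qed
    then show ?thesis using Int_atLeast_eq_singletonI fS f(1) less_imp_le by metis
  qed
  show ?thesis
  proof (cases "f = Suc g")
    \<comment> \<open>Now \<open>g\<close> and \<open>Suc g\<close> are both empty, so the third
      configuration leaves only \<open>f\<close> to \<open>T\<close> as well.\<close>
    case False
    then have g1: "g < Suc g" "Suc g < f" using f(1) by auto
    then have "Suc g \<notin> S \<union> T" using fmin[of "Suc g"] by auto
    have "x = f" if "x \<in> T" "g \<le> x" for x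
    proof (rule ccontr)
      assume "x \<noteq> f"
      then have "f < x" using fmin[of x] that mex(2) by (metis UnI2 le_less)
      then show False
        using free_pairD(3)[OF free(2) g1] mex(2) gS fS fT that \<open>Suc g \<notin> S \<union> T\<close> by blast
    qed
    then have "T \<inter> {g..} = {f}" using Int_atLeast_eq_singletonI fT f(1) less_imp_le by metis
    then show ?thesis
      using exchange_window_single[OF dom(1,3) S _ \<open>g \<le> r\<close> r(1) z] by blast
  next
    \<comment> \<open>\<open>T\<close> may continue beyond \<open>f\<close>, so the window is just
      the rows \<open>g\<close> and \<open>f\<close>. The box \<open>s\<close> beyond
      \<open>r\<close> must be \<open>f\<close>, which pins \<open>r\<close> to \<open>g\<close>;
      this gap of \<open>B\<close> then balances it at \<open>?q\<close>.\<close>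
    case True
    have "s = f" using S s \<open>g \<le> r\<close> by (metis IntI atLeast_iff le_trans less_imp_le singletonD)
    then have rg: "r = g" using s \<open>g \<le> r\<close> True by simp
    let ?q = "Suc (Suc g)"
    have Sq: "S \<inter> {?q..} = {}"
    proof -
      have "S \<inter> {?q..} = (S \<inter> {g..}) \<inter> {?q..}" by auto
      then show ?thesis using S True by simp
    qed
    have "splits g A S" using dominated_single(2)[OF dom(1) S r(1) \<open>g \<le> r\<close>] .
    moreover have "splits ?q A S" using dominated_above_empty(2)[OF dom(1) Sq] .
    moreover have "splits g B T" using dominated_initial(2)[OF dom(3) mex(3)] by simp
    moreover have "splits ?q B T"
    proof (rule dominated_hole(2)[OF dom(3) _ mex(2)])
      show "{..<?q} - {g} \<subseteq> T" using mex(3) fT True by (auto simp: less_Suc_eq)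
    qed (use r rg in auto)
    moreover have "{g..<?q} = {g, f}" using True by auto
    then have "S \<inter> {g..<?q} = T \<inter> {g..<?q}" using fS fT gS mex(2) by simp
    ultimately have "exchange_window S T A B r g ?q" by (simp add: exchange_window_def rg)
    then show ?thesis by blast
  qed
qed

text \<open>Below \<open>h\<close> the gap of \<open>B\<close> and of \<open>A'\<close> sits in row
  \<open>r\<close>, so both contain every row before \<open>r\<close>, and so does \<open>A\<close>.
  The end \<open>h\<close> is balanced for two different reasons: \<open>S\<close> stops there,
  while \<open>B\<close> has exactly one gap below it.\<close>

lemma exchange_window_interval:
  assumes dom: "dominated A S" "dominated A' S" "dominated B T"
    and agree: "\<And>i. i < r \<Longrightarrow> i \<in> A \<longleftrightarrow> i \<in> A'"
    and r: "r \<in> A" "r \<notin> A'" "r \<notin> B"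
    and hole: "{..<h} - {e} \<subseteq> S" "{..<h} - {e} \<subseteq> T" "e \<notin> S" "e \<notin> T" "e < h"
    and S: "S \<inter> {h..} = {}"
  shows "exchange_window S T A B r e h"
proof -
  have init: "{..<e} \<subseteq> S" "{..<e} \<subseteq> T" using hole by auto
  have "e \<le> r" using dominated_initial(1)[OF dom(3) init(2)] r(3) by (meson lessThan_iff not_le subsetD)
  obtain s where s: "s \<in> S" "r < s" using dominated_diff_above(2)[OF dom(1,2) agree r(1,2)] by blast
  then have "r < h" using S by (metis IntI atLeast_iff empty_iff less_trans not_le)
  have B: "B \<inter> {..<h} = {..<h} - {r}" "splits h B T"
    using dominated_hole[OF dom(3) hole(2,4,5) r(3) \<open>r < h\<close>] by auto
  have A': "A' \<inter> {..<h} = {..<h} - {r}"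
    using dominated_hole(1)[OF dom(2) hole(1,3,5) r(2) \<open>r < h\<close>] .
  have "i \<in> A \<and> i \<in> B" if "i < r" for i
  proof -
    have "i \<in> {..<h} - {r}" using that \<open>r < h\<close> by auto
    then show ?thesis using A' B(1) agree[OF that] by blast
  qed
  then have "A \<inter> {e..<r} = B \<inter> {e..<r}" by auto
  moreover have "S \<inter> {e..<h} = T \<inter> {e..<h}"
  proof -
    have "X \<inter> {e..<h} = {Suc e..<h}" if "{..<h} - {e} \<subseteq> X" "e \<notin> X" for X
      using that by (auto simp: Suc_le_eq le_less)
    then show ?thesis using hole by metis
  qed
  ultimately show ?thesis
    using B(2) \<open>e \<le> r\<close> \<open>r < h\<close> dominated_initial(2)[OF dom(1) init(1)]
      dominated_initial(2)[OF dom(3) init(2)] dominated_above_empty(2)[OF dom(1) S]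
    by (simp add: exchange_window_def)
qed

text \<open>For \<open>r < h\<close> the gaps of \<open>A'\<close> and \<open>B\<close> again sit at
  \<open>r\<close>, but \<open>A\<close> need not be balanced at \<open>h\<close>, so the window
  runs past the last box \<open>u\<close>.\<close>

lemma exchange_window_same:
  assumes dom: "dominated A S" "dominated A' S" "dominated B S" "dominated B' S"
    and agree: "\<And>i. i < r \<Longrightarrow> i \<in> A \<longleftrightarrow> i \<in> A'" "\<And>i. i < r \<Longrightarrow> i \<in> B' \<longleftrightarrow> i \<in> B"
    and r: "r \<in> A" "r \<notin> A'" "r \<in> B'" "r \<notin> B"
    and hole: "{..<h} - {e} \<subseteq> S" "e \<notin> S" "e < h"
    and S: "S \<inter> {h..} = {u}"
  shows "\<exists>p q. exchange_window S S A B r p q"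
proof (cases "h \<le> r")
  case True
  obtain z where "z \<in> B" "r < z" using dominated_diff_above(1)[OF dom(4,3) agree(2) r(3,4)] by blast
  then show ?thesis using exchange_window_single[OF dom(1,3) S S True r(1)] by blast
next
  case False
  then have "r < h" by simp
  have init: "{..<e} \<subseteq> S" using hole by auto
  have "e \<le> r" using dominated_initial(1)[OF dom(3) init] r(4) by (meson lessThan_iff not_le subsetD)
  have B: "B \<inter> {..<h} = {..<h} - {r}"
    using dominated_hole(1)[OF dom(3) hole r(4) \<open>r < h\<close>] .
  have A': "A' \<inter> {..<h} = {..<h} - {r}"
    using dominated_hole(1)[OF dom(2) hole r(2) \<open>r < h\<close>] .
  have "i \<in> A \<and> i \<in> B" if "i < r" for i
  proof -
    have "i \<in> {..<h} - {r}" using that \<open>r < h\<close> by auto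
    then show ?thesis using A' B(1) agree[OF that] by blast
  qed
  then have "A \<inter> {e..<r} = B \<inter> {e..<r}" by auto
  moreover have "h \<le> u" using S by auto
  moreover have "S \<inter> {Suc u..} = {}"
  proof -
    have "S \<inter> {Suc u..} = (S \<inter> {h..}) \<inter> {Suc u..}" using \<open>h \<le> u\<close> by auto
    then show ?thesis using S by simp
  qed
  ultimately have "exchange_window S S A B r e (Suc u)"
    using \<open>e \<le> r\<close> \<open>r < h\<close> dominated_initial(2)[OF dom(1) init]
      dominated_initial(2)[OF dom(3) init] dominated_above_empty(2)[OF dom(1)]
      dominated_above_empty(2)[OF dom(3)]
    by (simp add: exchange_window_def)
  then show ?thesis by blast
qed

text \<open>The exchange may be possible only on one side: with \<open>S = {1}\<close>, \<open>T = {1, 2}\<close>,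
  \<open>A = {0}\<close>, \<open>B = {1, 2}\<close>, \<open>A' = {1}\<close>, \<open>B' = {0, 1}\<close> and \<open>r = 0\<close> it works for
  \<open>(A, B)\<close> but not for \<open>(A', B')\<close>.\<close>

lemma exchange_window_exists:
  assumes free: "free_pair S T" "free_pair T S"
    and dom: "dominated A S" "dominated A' S" "dominated B T" "dominated B' T"
    and agree: "\<And>i. i < r \<Longrightarrow> i \<in> A \<longleftrightarrow> i \<in> A'" "\<And>i. i < r \<Longrightarrow> i \<in> B' \<longleftrightarrow> i \<in> B"
    and r: "r \<in> A" "r \<notin> A'" "r \<in> B'" "r \<notin> B"
  shows "(\<exists>p q. exchange_window S T A B r p q) \<or> (\<exists>p q. exchange_window T S B' A' r p q)"
proof -
  have fin: "finite S" "finite T" using dom by (auto simp: dominated_def)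
  have mex: "\<exists>m. m \<notin> X \<and> {..<m} \<subseteq> X" if "finite X" for X :: "nat set"
  proof -
    define m where "m = (LEAST m. m \<notin> X)"
    have "\<exists>m. m \<notin> X" using that ex_new_if_finite by blast
    then have "m \<notin> X" unfolding m_def by (rule LeastI_ex)
    moreover have "{..<m} \<subseteq> X" unfolding m_def using not_less_Least by blast
    ultimately show ?thesis by blast
  qed
  \<comment> \<open>The cases compare the first missing rows of the two columns. The case
    \<open>g < e\<close> is \<open>e < g\<close> with the columns and the two diagrams
    interchanged.\<close>
  obtain e where e: "e \<notin> S" "{..<e} \<subseteq> S" using mex[OF fin(1)] by blast
  obtain g where g: "g \<notin> T" "{..<g} \<subseteq> T" using mex[OF fin(2)] by blast
  consider "e < g" | "g < e" | "e = g" by linarith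
  then show ?thesis
  proof cases
    case 1
    then show ?thesis
      using exchange_window_mex_less[OF free dom agree r e(1) g] by blast
  next
    case 2
    then show ?thesis
      using exchange_window_mex_less[OF free(2,1) dom(4,3,2,1) agree(2,1) r(3,4,1,2) g(1) e]
      by blast
  next
    case 3
    \<comment> \<open>\<open>h\<close> is the first row after the common gap that is not full in
      both columns, so before \<open>h\<close> both consist of everything but
      \<open>e\<close>.\<close>
    define h where "h = (LEAST h. e < h \<and> h \<notin> S \<inter> T)"
    have "\<exists>h. e < h \<and> h \<notin> S \<inter> T"
      using ex_new_if_finite[of "S \<inter> T \<union> {..e}"] fin by (auto simp: not_le)
    then have h: "e < h" "h \<notin> S \<inter> T"
      unfolding h_def using LeastI_ex[of "\<lambda>h. e < h \<and> h \<notin> S \<inter> T"] by blast+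
    have "i \<in> S \<inter> T" if "i < h" "i \<noteq> e" for i
      using that e g 3 not_less_Least[of i "\<lambda>h. e < h \<and> h \<notin> S \<inter> T", folded h_def]
      by (metis IntI lessThan_iff linorder_neqE_nat subsetD)
    then have hole: "{..<h} - {e} \<subseteq> S" "{..<h} - {e} \<subseteq> T" by auto
    have eT: "e \<notin> T" using 3 g by simp
    show ?thesis
    proof (cases "\<exists>u\<ge>h. u \<in> S \<inter> T")
      \<comment> \<open>Row \<open>h\<close> is empty in both columns by the first configuration on
        \<open>e\<close>, \<open>h\<close>, \<open>u\<close>. With \<open>e\<close> and
        \<open>h\<close> empty, the first and third configurations allow no other box from
        \<open>h\<close> on, so the columns coincide.\<close>
      case True
      then obtain u where u: "h \<le> u" "u \<in> S" "u \<in> T" by blast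
      then have "h < u" using h by (metis IntI le_less)
      have hST: "h \<notin> S" "h \<notin> T"
        using free_pairD(1)[OF free(1) h(1) \<open>h < u\<close>] free_pairD(1)[OF free(2) h(1) \<open>h < u\<close>]
          e(1) eT u h(2) by blast+
      have uniq: "x = u" if "h \<le> x" "x \<in> S \<union> T" for x
      proof (rule ccontr)
        assume "x \<noteq> u"
        have "h < x" "e < x" using that hST h(1) by (auto simp: le_less)
        show False
        proof (cases "u < x")
          case True
          then show False
            using free_pairD(3)[OF free(1) h(1) \<open>h < u\<close>, of x] free_pairD(3)[OF free(2) h(1) \<open>h < u\<close>, of x]
              e(1) eT hST u that by blast
        next
          case False
          then have "x < u" using \<open>x \<noteq> u\<close> by simp
          then show False
            using free_pairD(3)[OF free(1) h(1) \<open>h < x\<close>, of u]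
              free_pairD(1)[OF free(1) \<open>e < x\<close>, of u] free_pairD(1)[OF free(2) \<open>e < x\<close>, of u]
              e(1) eT hST u that by blast
        qed
      qed
      then have ST: "S \<inter> {h..} = {u}" "T \<inter> {h..} = {u}"
        using Int_atLeast_eq_singletonI u by (metis UnI1, metis UnI2)
      have "S = T"
      proof (rule Set.set_eqI)
        fix x
        show "x \<in> S \<longleftrightarrow> x \<in> T"
          using hole e(1) eT uniq[of x] u by (cases "x < h"; cases "x = e") auto
      qed
      then show ?thesis
        using exchange_window_same[OF dom[folded \<open>S = T\<close>] agree r hole(1) e(1) h(1) ST(1)] by blast
    next
      case False
      \<comment> \<open>Boxes of both columns, never in a common row, would complete the first
        configuration under the empty row \<open>e\<close>. So one column ends before
        \<open>h\<close>; which one decides on which side the window is found.\<close>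
      have "S \<inter> {h..} = {} \<or> T \<inter> {h..} = {}"
      proof (rule ccontr)
        assume "\<not> ?thesis"
        then obtain x y where xy: "x \<in> S" "h \<le> x" "y \<in> T" "h \<le> y" by auto
        then have "x \<notin> T" "y \<notin> S" "e < x" "e < y" using False h(1) by auto
        then show False
          using free_pairD(1)[OF free(1) \<open>e < x\<close>, of y] free_pairD(1)[OF free(2) \<open>e < y\<close>, of x] xy
            e(1) eT by (metis linorder_neqE_nat)
      qed
      then show ?thesis
        using exchange_window_interval[OF dom(1-3) agree(1) r(1,2,4) hole e(1) eT h(1)]
          exchange_window_interval[OF dom(4,3,2) agree(2) r(3,4,2) hole(2,1) eT e(1) h(1)] by blast
    qed
  qed
qed

section \<open>Minors of the upper triangular matrix\<close>

text \<open>The linear order on \<open>nat \<times> nat\<close> from the imported theory makes \<open>ypoly\<close> an integral domain,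
  which the determinant formula for block triangular matrices asks for.\<close>

abbreviation minor :: "nat \<Rightarrow> nat set \<Rightarrow> nat set \<Rightarrow> ypoly" where
  "minor n R S \<equiv> det (submatrix (Ymat n) R S)"

lemma pick_Int_lessThan:
  assumes "i < card (X \<inter> {..<t})"
  shows "pick (X \<inter> {..<t}) i = pick X i"
proof -
  have "{a. a < t \<and> a \<in> X} = X \<inter> {..<t}" by auto
  then show ?thesis using pick_reduce_set[of i t X] assms by simp
qed

lemma pick_Int_atLeast:
  assumes "finite X" "i < card (X \<inter> {t..})"
  shows "pick (X \<inter> {t..}) i = pick X (card (X \<inter> {..<t}) + i)"
proof -
  let ?x = "pick (X \<inter> {t..}) i"
  have x: "?x \<in> X \<inter> {t..}" using pick_in_set_le[OF assms(2)] .
  have "{a \<in> X. a < ?x} = (X \<inter> {..<t}) \<union> {a \<in> X \<inter> {t..}. a < ?x}" using x by auto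
  also have "card \<dots> = card (X \<inter> {..<t}) + card {a \<in> X \<inter> {t..}. a < ?x}"
    using assms(1) by (intro card_Un_disjoint) auto
  also have "\<dots> = card (X \<inter> {..<t}) + i" using card_pick_le[OF assms(2)] by simp
  finally show ?thesis using pick_card_in_set[of ?x X] x by simp
qed

lemma submatrix_Ymat:
  assumes "A \<subseteq> {..<n}" "S \<subseteq> {..<n}"
  shows "submatrix (Ymat n) A S = mat (card A) (card S)
    (\<lambda>(i, j). if pick A i \<le> pick S j then mvar (pick A i, pick S j) else 0)"
proof -
  have c: "{i. i < n \<and> i \<in> X} = X" if "X \<subseteq> {..<n}" for X using that by auto
  have p: "pick X i < n" if "X \<subseteq> {..<n}" "i < card X" for X i
    using pick_in_set_le[OF that(2)] that(1) by auto
  show ?thesis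
    unfolding submatrix_def by (rule eq_matI) (auto simp: Ymat_def c assms p)
qed

text \<open>Rows at or beyond \<open>t\<close> meet columns before \<open>t\<close> below the
  diagonal, so the matrix is block upper triangular; equal counts make its diagonal blocks
  square.\<close>

lemma minor_split:
  assumes AS: "A \<subseteq> {..<n}" "S \<subseteq> {..<n}" "card A = card S" and t: "splits t A S"
  shows "minor n A S =
    minor n (A \<inter> {..<t}) (S \<inter> {..<t}) * minor n (A \<inter> {t..}) (S \<inter> {t..})"
proof -
  have fin: "finite A" "finite S" using AS finite_subset by auto
  define k where "k = card (A \<inter> {..<t})"
  define l where "l = card (A \<inter> {t..})"
  have l: "card (S \<inter> {t..}) = l" using t by (simp add: splits_def l_def)
  have A: "card A = k + l" using card_lessThan_split[OF fin(1), of t] by (simp add: k_def l_def)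
  have S: "card S = k + l" using AS(3) A by simp
  have k: "card (S \<inter> {..<t}) = k" using card_lessThan_split[OF fin(2), of t] S l by simp
  let ?M = "\<lambda>A S. submatrix (Ymat n) A S"
  let ?N = "mat k l (\<lambda>(i, j). ?M A S $$ (i, k + j))"
  have car: "?M (A \<inter> {..<t}) (S \<inter> {..<t}) \<in> carrier_mat k k"
    "?M (A \<inter> {t..}) (S \<inter> {t..}) \<in> carrier_mat l l"
    using AS by (subst submatrix_Ymat; force simp: k l k_def l_def)+
  have lowA: "pick (A \<inter> {..<t}) i = pick A i" if "i < k" for i
    using pick_Int_lessThan that by (simp add: k_def)
  have lowS: "pick (S \<inter> {..<t}) i = pick S i" if "i < k" for i
    using pick_Int_lessThan that k by simp
  have highA: "pick (A \<inter> {t..}) i = pick A (k + i)" if "i < l" for i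
    using pick_Int_atLeast[OF fin(1)] that by (simp add: k_def l_def)
  have highS: "pick (S \<inter> {t..}) i = pick S (k + i)" if "i < l" for i
    using pick_Int_atLeast[OF fin(2)] that k l by simp
  have zero: "pick S j < pick A i" if "k \<le> i" "i < k + l" "j < k" for i j
  proof -
    have "pick S j < t" using pick_in_set_le[of j "S \<inter> {..<t}"] lowS that k by simp
    moreover have "t \<le> pick A i"
      using pick_in_set_le[of "i - k" "A \<inter> {t..}"] highA[of "i - k"] that by (simp add: l_def)
    ultimately show ?thesis by simp
  qed
  have sub: "X \<inter> Y \<subseteq> {..<n}" if "X \<subseteq> {..<n}" for X Y using that by blast
  have "?M A S = four_block_mat (?M (A \<inter> {..<t}) (S \<inter> {..<t})) ?N (0\<^sub>m l k)
      (?M (A \<inter> {t..}) (S \<inter> {t..}))"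
  proof (rule eq_matI, goal_cases)
    case (1 i j)
    then have ij: "i < k + l" "j < k + l" using car by auto
    have hA: "pick (A \<inter> {t..}) (i - k) = pick A i" if "k \<le> i" using highA[of "i - k"] ij that by simp
    have hS: "pick (S \<inter> {t..}) (j - k) = pick S j" if "k \<le> j" using highS[of "j - k"] ij that by simp
    show ?case
      using ij lowA[of i] lowS[of j] zero[of i j] hA hS
      by (auto simp: submatrix_Ymat AS sub A S k l k_def[symmetric] l_def[symmetric] not_less)
  next
    case 2
    then show ?case by (simp add: submatrix_Ymat AS(1,2) sub A k_def[symmetric] l_def[symmetric])
  next
    case 3
    then show ?case by (simp add: submatrix_Ymat AS(1,2) sub S k l)
  qed
  then show ?thesis
    using det_four_block_mat_lower_left_zero[OF car(1) _ refl car(2), of ?N] by simp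
qed

lemma minor_window_split:
  assumes AS: "dominated A S" "S \<subseteq> {..<n}" "p \<le> q" and pq: "splits p A S" "splits q A S"
  shows "minor n A S = minor n (A \<inter> {..<p}) (S \<inter> {..<p}) *
    (minor n (A \<inter> {p..<q}) (S \<inter> {p..<q}) * minor n (A \<inter> {q..}) (S \<inter> {q..}))"
proof -
  have "S \<inter> {n..} = {}" using AS(2) by auto
  then have An: "A \<subseteq> {..<n}" using dominated_above_empty(1)[OF AS(1), of n] by fastforce
  have c: "card A = card S" using AS(1) by (simp add: dominated_def)
  have int: "X \<inter> {p..} \<inter> {..<q} = X \<inter> {p..<q}" "X \<inter> {p..} \<inter> {q..} = X \<inter> {q..}" for X
    using AS(3) by auto
  have "minor n (A \<inter> {p..}) (S \<inter> {p..}) =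
      minor n (A \<inter> {p..} \<inter> {..<q}) (S \<inter> {p..} \<inter> {..<q}) *
      minor n (A \<inter> {p..} \<inter> {q..}) (S \<inter> {p..} \<inter> {q..})"
  proof (rule minor_split)
    show "card (A \<inter> {p..}) = card (S \<inter> {p..})" using pq(1) by (simp add: splits_def)
    show "splits q (A \<inter> {p..}) (S \<inter> {p..})" using pq(2) by (simp add: splits_def int)
  qed (use An AS(2) in blast)+
  then show ?thesis using minor_split[OF An AS(2) c pq(1)] by (simp add: int)
qed

text \<open>Each minor is a product of parts before, inside and beyond the window. As
  \<open>S\<close> and \<open>T\<close> agree inside it, the exchange merely passes the middle
  factors from one minor to the other.\<close>

lemma minor_swap_window:
  assumes AS: "dominated A S" "S \<subseteq> {..<n}" and BT: "dominated B T" "T \<subseteq> {..<n}" and pq: "p \<le> q"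
    and W: "S \<inter> {p..<q} = T \<inter> {p..<q}"
    and sp: "splits p A S" "splits q A S" "splits p B T" "splits q B T"
  shows "minor n (swap_window p q A B) S * minor n (swap_window p q B A) T =
    minor n A S * minor n B T"
  using minor_window_split[OF AS pq sp(1,2)] minor_window_split[OF BT pq sp(3,4)]
    minor_window_split[OF dominated_swap_window(1)[OF AS(1) BT(1) pq W sp] AS(2) pq
      dominated_swap_window(2,3)[OF AS(1) BT(1) pq W sp]]
    minor_window_split[OF dominated_swap_window(1)[OF BT(1) AS(1) pq W[symmetric] sp(3,4,1,2)] BT(2) pq
      dominated_swap_window(2,3)[OF BT(1) AS(1) pq W[symmetric] sp(3,4,1,2)]]
    swap_window_Int pq W
  by (simp add: mult.left_commute mult.commute)

section \<open>Iterating the exchange\<close>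

text \<open>The binary weights make an agreement in one row outweigh everything that happens in the
  rows below it.\<close>

definition discrepancy :: "nat \<Rightarrow> nat set \<Rightarrow> nat set \<Rightarrow> nat" where
  "discrepancy n A B = (\<Sum>i\<in>(A - B) \<union> (B - A). 2 ^ (n - i))"

lemma discrepancy_commute: "discrepancy n A B = discrepancy n B A"
  by (simp add: discrepancy_def Un_commute)

lemma discrepancy_less:
  assumes sub: "A \<subseteq> {..<n}" "A' \<subseteq> {..<n}" "B \<subseteq> {..<n}"
    and r: "r \<in> (A - B) \<union> (B - A)" and agree: "\<And>i. i \<le> r \<Longrightarrow> i \<in> A' \<longleftrightarrow> i \<in> B"
  shows "discrepancy n A' B < discrepancy n A B"
proof -
  let ?X = "(A' - B) \<union> (B - A')"
  have X: "?X \<subseteq> {Suc r..<n}" 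
  proof
    fix i
    assume i: "i \<in> ?X"
    then have "\<not> i \<le> r" using agree[of i] by blast
    moreover have "i < n" using i sub by blast
    ultimately show "i \<in> {Suc r..<n}" by simp
  qed
  have inj: "inj_on (\<lambda>i. n - i) ?X" 
    by (rule inj_on_subset[OF _ X]) (auto simp: inj_on_def)
  have "discrepancy n A' B = (\<Sum>e\<in>(\<lambda>i. n - i) ` ?X. 2 ^ e)"
    unfolding discrepancy_def by (simp add: sum.reindex[OF inj])
  \<comment> \<open>The remaining exponents are distinct and below \<open>n - r\<close>, so their
    powers sum to less than the single term that row \<open>r\<close> contributed.\<close>
  also have "\<dots> \<le> (\<Sum>e\<in>{0..<n - r}. 2 ^ e)"
  proof (rule sum_mono2)
    show "(\<lambda>i. n - i) ` ?X \<subseteq> {0..<n - r}"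
    proof (rule image_subsetI)
      fix i
      assume "i \<in> ?X"
      then have "i \<in> {Suc r..<n}" using X by blast
      then show "n - i \<in> {0..<n - r}" unfolding atLeastLessThan_iff by arith
    qed
  qed auto
  also have "\<dots> < 2 ^ (n - r)" by (simp add: sum_power2)
  also have "\<dots> \<le> discrepancy n A B"
    unfolding discrepancy_def using r sub finite_subset
    by (intro member_le_sum) (auto intro: finite_subset)
  finally show ?thesis .
qed

text \<open>Rows of the window only trade places between columns \<open>j\<close> and
  \<open>k\<close>, so the row counts survive. In both columns row \<open>r\<close> now agrees with
  \<open>g\<close> and no earlier row is disturbed, so both discrepancies drop.\<close>

lemma exchange_step:
  fixes f g S :: "nat \<Rightarrow> nat set"
  assumes S: "\<And>l. l < n \<Longrightarrow> S l \<subseteq> {..<n}"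
    and f: "\<And>l. l < n \<Longrightarrow> dominated (f l) (S l)" and g: "\<And>l. l < n \<Longrightarrow> dominated (g l) (S l)"
    and jk: "j < n" "k < n" "j \<noteq> k"
    and agree: "\<And>l i. l < n \<Longrightarrow> i < r \<Longrightarrow> i \<in> f l \<longleftrightarrow> i \<in> g l"
    and r: "r \<in> f j" "r \<notin> g j" "r \<in> g k" "r \<notin> f k"
    and win: "exchange_window (S j) (S k) (f j) (f k) r p q"
  shows "\<exists>f'. (\<forall>l<n. dominated (f' l) (S l)) \<and>
    (\<forall>i. card {l. l < n \<and> i \<in> f' l} = card {l. l < n \<and> i \<in> f l}) \<and>
    (\<Prod>l<n. minor n (f' l) (S l)) = (\<Prod>l<n. minor n (f l) (S l)) \<and>
    (\<Sum>l<n. discrepancy n (f' l) (g l)) < (\<Sum>l<n. discrepancy n (f l) (g l))"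
proof -
  let ?fj = "swap_window p q (f j) (f k)" and ?fk = "swap_window p q (f k) (f j)"
  define f' where "f' = f(j := ?fj, k := ?fk)"
  have f': "f' j = ?fj" "f' k = ?fk" "\<And>l. l \<noteq> j \<Longrightarrow> l \<noteq> k \<Longrightarrow> f' l = f l"
    using jk by (auto simp: f'_def)
  have w: "p \<le> q" "S j \<inter> {p..<q} = S k \<inter> {p..<q}" "splits p (f j) (S j)" "splits q (f j) (S j)"
    "splits p (f k) (S k)" "splits q (f k) (S k)" and pr: "p \<le> r" "r < q"
    and fjk: "f j \<inter> {p..<r} = f k \<inter> {p..<r}"
    using win by (auto simp: exchange_window_def)
  have dj: "dominated ?fj (S j)" using dominated_swap_window(1)[OF f[OF jk(1)] f[OF jk(2)] w] .
  have dk: "dominated ?fk (S k)"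
    using dominated_swap_window(1)[OF f[OF jk(2)] f[OF jk(1)] w(1) w(2)[symmetric] w(5,6,3,4)] .
  have dom: "dominated (f' l) (S l)" if "l < n" for l
    using dj dk f[OF that] f' by (cases "l = j"; cases "l = k") auto
  have sub: "X \<subseteq> {..<n}" if "dominated X (S l)" "l < n" for X l
  proof -
    have "S l \<inter> {n..} = {}" using S[OF that(2)] by auto
    from dominated_above_empty(1)[OF that(1) this] show ?thesis by fastforce
  qed
  have count: "card {l. l < n \<and> i \<in> f' l} = card {l. l < n \<and> i \<in> f l}" for i
  proof (cases "i \<in> {p..<q}")
    case True
    have mem: "i \<in> f' l \<longleftrightarrow> i \<in> f (Transposition.transpose j k l)" for l
      using True f' by (cases "l = j"; cases "l = k") (auto simp: swap_window_def transpose_def)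
    have lt: "Transposition.transpose j k l < n \<longleftrightarrow> l < n" for l
      using jk by (auto simp: transpose_def)
    have "bij_betw (Transposition.transpose j k) {l. l < n \<and> i \<in> f' l} {l. l < n \<and> i \<in> f l}"
      by (rule bij_betwI[where g = "Transposition.transpose j k"]) (auto simp: mem lt)
    then show ?thesis by (rule bij_betw_same_card)
  next
    case False
    then have "i \<in> f' l \<longleftrightarrow> i \<in> f l" for l
      using f' by (cases "l = j"; cases "l = k") (auto simp: swap_window_def)
    then show ?thesis by simp
  qed
  have two: "{..<n} = insert j (insert k ({..<n} - {j, k}))" using jk by auto
  have "(\<Prod>l<n. minor n (f' l) (S l)) = (\<Prod>l<n. minor n (f l) (S l))"
  proof -
    have "(\<Prod>l\<in>{..<n} - {j, k}. minor n (f' l) (S l)) = (\<Prod>l\<in>{..<n} - {j, k}. minor n (f l) (S l))"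
      by (intro prod.cong) (auto simp: f')
    then show ?thesis
      using minor_swap_window[OF f[OF jk(1)] S[OF jk(1)] f[OF jk(2)] S[OF jk(2)] w] jk
      by (subst (1 2) two) (simp add: f' mult.assoc[symmetric])
  qed
  moreover have "(\<Sum>l<n. discrepancy n (f' l) (g l)) < (\<Sum>l<n. discrepancy n (f l) (g l))"
  proof -
    have "i \<in> ?fj \<longleftrightarrow> i \<in> g j" if "i \<le> r" for i
    proof (cases "i = r")
      case True
      then show ?thesis using r pr by (auto simp: swap_window_def)
    next
      case False
      then have "i < r" using that by simp
      then have "i \<in> ?fj \<longleftrightarrow> i \<in> f j" using fjk pr by (auto simp: swap_window_def set_eq_iff)
      then show ?thesis using agree[OF jk(1) \<open>i < r\<close>] by simp
    qed
    then have "discrepancy n (f' j) (g j) < discrepancy n (f j) (g j)"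
      unfolding f'(1)
      using discrepancy_less[OF sub[OF f[OF jk(1)] jk(1)] sub[OF dj jk(1)] sub[OF g[OF jk(1)] jk(1)]] r
      by blast
    moreover have "i \<in> ?fk \<longleftrightarrow> i \<in> g k" if "i \<le> r" for i
    proof (cases "i = r")
      case True
      then show ?thesis using r pr by (auto simp: swap_window_def)
    next
      case False
      then have "i < r" using that by simp
      then have "i \<in> ?fk \<longleftrightarrow> i \<in> f k" using fjk pr by (auto simp: swap_window_def set_eq_iff)
      then show ?thesis using agree[OF jk(2) \<open>i < r\<close>] by simp
    qed
    then have "discrepancy n (f' k) (g k) < discrepancy n (f k) (g k)"
      unfolding f'(2)
      using discrepancy_less[OF sub[OF f[OF jk(2)] jk(2)] sub[OF dk jk(2)] sub[OF g[OF jk(2)] jk(2)]] r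
      by blast
    moreover have "(\<Sum>l\<in>{..<n} - {j, k}. discrepancy n (f' l) (g l)) =
        (\<Sum>l\<in>{..<n} - {j, k}. discrepancy n (f l) (g l))"
      by (intro sum.cong) (auto simp: f')
    ultimately show ?thesis using jk(3) by (subst (1 2) two) simp
  qed
  ultimately show ?thesis using dom count by blast
qed

lemma minor_prod_eq:
  fixes f g S :: "nat \<Rightarrow> nat set"
  assumes S: "\<And>l. l < n \<Longrightarrow> S l \<subseteq> {..<n}"
    and free: "\<And>j k. j < n \<Longrightarrow> k < n \<Longrightarrow> j \<noteq> k \<Longrightarrow> free_pair (S j) (S k)"
    and "\<And>l. l < n \<Longrightarrow> dominated (f l) (S l)" and "\<And>l. l < n \<Longrightarrow> dominated (g l) (S l)"
    and "\<And>i. card {l. l < n \<and> i \<in> f l} = card {l. l < n \<and> i \<in> g l}"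
  shows "(\<Prod>l<n. minor n (f l) (S l)) = (\<Prod>l<n. minor n (g l) (S l))"
  using assms(3-)
proof (induction "\<Sum>l<n. discrepancy n (f l) (g l)" arbitrary: f g rule: less_induct)
  case less
  note f = less.prems(1) and g = less.prems(2) and count = less.prems(3)
  show ?case
  proof (cases "\<forall>l<n. f l = g l")
    case True
    then show ?thesis by simp
  next
    case False
    let ?P = "\<lambda>r. \<exists>l<n. r \<in> (f l - g l) \<union> (g l - f l)"
    define r where "r = (LEAST r. ?P r)"
    have "\<exists>r. ?P r" using False by blast
    then have Pr: "?P r" unfolding r_def by (rule LeastI_ex)
    have agree: "i \<in> f l \<longleftrightarrow> i \<in> g l" if "l < n" "i < r" for l i
      using not_less_Least[of i ?P] that unfolding r_def by blast
    let ?F = "{l. l < n \<and> r \<in> f l}" and ?G = "{l. l < n \<and> r \<in> g l}"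
    \<comment> \<open>Row \<open>r\<close> has equally many boxes in both families, so two different
      sets of columns cannot be nested; this gives a column for each direction.\<close>
    have "?F \<noteq> ?G" using Pr by auto
    then have "\<not> ?F \<subseteq> ?G" "\<not> ?G \<subseteq> ?F"
      using count[of r] card_subset_eq[of ?G ?F] card_subset_eq[of ?F ?G] by auto
    then obtain j k where jk: "j < n" "r \<in> f j" "r \<notin> g j" "k < n" "r \<in> g k" "r \<notin> f k" by blast
    then have "j \<noteq> k" by auto
    consider p q where "exchange_window (S j) (S k) (f j) (f k) r p q"
      | p q where "exchange_window (S k) (S j) (g k) (g j) r p q"
      using exchange_window_exists[OF free[OF jk(1,4) \<open>j \<noteq> k\<close>] free[OF jk(4,1) \<open>j \<noteq> k\<close>[symmetric]]
          f[OF jk(1)] g[OF jk(1)] f[OF jk(4)] g[OF jk(4)] agree[OF jk(1)] agree[OF jk(4), symmetric]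
          jk(2,3,5,6)] by blast
    then show ?thesis
    proof cases
      case 1
      from exchange_step[OF S f g jk(1,4) \<open>j \<noteq> k\<close> agree jk(2,3,5,6) 1] obtain f' where
        "\<forall>l<n. dominated (f' l) (S l)"
        "\<forall>i. card {l. l < n \<and> i \<in> f' l} = card {l. l < n \<and> i \<in> f l}"
        "(\<Prod>l<n. minor n (f' l) (S l)) = (\<Prod>l<n. minor n (f l) (S l))"
        "(\<Sum>l<n. discrepancy n (f' l) (g l)) < (\<Sum>l<n. discrepancy n (f l) (g l))"
        by blast
      then show ?thesis using less.hyps[of f' g] g count by simp
    next
      \<comment> \<open>Here \<open>g\<close> is changed and \<open>f\<close> is kept; the induction
        measure is symmetric in the two.\<close>
      case 2
      from exchange_step[OF S g f jk(4,1) \<open>j \<noteq> k\<close>[symmetric] agree[symmetric] jk(5,6,2,3) 2]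
      obtain g' where
        "\<forall>l<n. dominated (g' l) (S l)"
        "\<forall>i. card {l. l < n \<and> i \<in> g' l} = card {l. l < n \<and> i \<in> g l}"
        "(\<Prod>l<n. minor n (g' l) (S l)) = (\<Prod>l<n. minor n (g l) (S l))"
        "(\<Sum>l<n. discrepancy n (g' l) (f l)) < (\<Sum>l<n. discrepancy n (g l) (f l))"
        by blast
      then show ?thesis using less.hyps[of f g'] f count
        by (simp add: discrepancy_commute[of n _ "f _"])
    qed
  qed
qed

section \<open>From columns back to diagrams\<close>

lemma dcol_subset: "is_diagram n D \<Longrightarrow> dcol D j \<subseteq> {..<n}"
  by (auto simp: is_diagram_def dcol_def)

text \<open>Every configuration has a box in its third or fourth row, and that box keeps
  \<open>i3\<close> in the grid, as \<open>multiplicitous\<close> demands.\<close>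

lemma multiplicity_free_free_pair:
  assumes "is_diagram n D" "multiplicity_free n D" "j < n" "k < n" "j \<noteq> k"
  shows "free_pair (dcol D j) (dcol D k)"
proof (rule ccontr)
  assume "\<not> ?thesis"
  then obtain i1 i2 i3 i4 where i: "i1 < i2" "i2 < i3" "i3 < i4" and
    P: "\<exists>P\<in>configurations. list_all2 (\<lambda>i (s, t). has_status D (i, j) s \<and> has_status D (i, k) t)
        [i1, i2, i3, i4] P \<and> ((i3, j) \<in> D \<or> (i3, k) \<in> D \<or> (i4, j) \<in> D \<or> (i4, k) \<in> D)"
    unfolding free_pair_def configurations_def dcol_def by auto
  have "i3 < n" using P i(3) assms(1) by (auto simp: is_diagram_def)
  then have "multiplicitous n D" using i P assms(3-) unfolding multiplicitous_def by blast
  then show False using assms(2) by (simp add: multiplicity_free_def)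
qed

lemma diagram_le_dominated:
  assumes "is_diagram n C" "is_diagram n D" "diagram_le n C D" "j < n"
  shows "dominated (dcol C j) (dcol D j)"
  using assms gale_le_iff_dominated[of "dcol C j" "dcol D j"]
    finite_subset[OF dcol_subset] unfolding diagram_le_def by blast

lemma diagram_det_eq:
  assumes D: "is_diagram n D" "multiplicity_free n D"
    and C: "is_diagram n C" "diagram_le n C D" and C': "is_diagram n C'" "diagram_le n C' D"
    and weight: "\<And>i. card {j. (i, j) \<in> C} = card {j. (i, j) \<in> C'}"
  shows "diagram_det n C D = diagram_det n C' D"
  unfolding diagram_det_def
proof (rule minor_prod_eq)
  have "{l. l < n \<and> i \<in> dcol X l} = {j. (i, j) \<in> X}" if "is_diagram n X" for i X
    using that by (auto simp: is_diagram_def dcol_def)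
  then show "card {l. l < n \<and> i \<in> dcol C l} = card {l. l < n \<and> i \<in> dcol C' l}" for i
    using C C' weight by simp
qed (use D C C' dcol_subset multiplicity_free_free_pair diagram_le_dominated in auto)

section \<open>The character\<close>

lemma mconst_simps:
  "mconst 0 = 0" "mconst 1 = 1" "mconst (a + b) = mconst a + mconst b"
  "mconst (a * b) = mconst a * (mconst b :: ('v, 'a::comm_semiring_1) mpoly)"
  by (simp_all add: mconst_def single_add mult_single)

lemma lookup_mconst_mult:
  "Poly_Mapping.lookup (mconst c * p) m = c * Poly_Mapping.lookup (p :: ('v, 'a::comm_ring_1) mpoly) m"
  by (simp add: mconst_def mult_map_scale_conv_mult[symmetric] Poly_Mapping.map.rep_eq when_def)

lemma mconst_prod: "mconst (\<Prod>i\<in>I. c i) = (\<Prod>i\<in>I. mconst (c i) :: ('v, 'a::comm_semiring_1) mpoly)"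
  by (induction I rule: infinite_finite_induct) (simp_all add: mconst_simps)

lemma mconst_power: "mconst (c ^ k) = (mconst c :: ('v, 'a::comm_semiring_1) mpoly) ^ k"
  by (induction k) (simp_all add: mconst_simps)

lemma sum_single_lookup:
  "(\<Sum>m\<in>Poly_Mapping.keys p. Poly_Mapping.single m (Poly_Mapping.lookup p m)) = p"
proof (rule poly_mapping_eqI)
  fix k
  have "Poly_Mapping.lookup (\<Sum>m\<in>Poly_Mapping.keys p. Poly_Mapping.single m (Poly_Mapping.lookup p m)) k =
      (\<Sum>m\<in>Poly_Mapping.keys p. if m = k then Poly_Mapping.lookup p m else 0)"
    by (simp add: lookup_sum lookup_single when_def)
  also have "\<dots> = Poly_Mapping.lookup p k" by (simp add: in_keys_iff)
  finally show "Poly_Mapping.lookup (\<Sum>m\<in>Poly_Mapping.keys p.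
    Poly_Mapping.single m (Poly_Mapping.lookup p m)) k = Poly_Mapping.lookup p k" .
qed

lemma mvar_power: "(mvar v :: ('v, 'a::comm_semiring_1) mpoly) ^ k = Poly_Mapping.single (Poly_Mapping.single v k) 1"
  by (induction k) (simp_all add: mvar_def mult_single single_add[symmetric])

lemma prod_mvar_power:
  "(\<Prod>v\<in>Poly_Mapping.keys m. (mvar v :: ('v, 'a::comm_semiring_1) mpoly) ^ Poly_Mapping.lookup m v) =
    Poly_Mapping.single m 1"
proof -
  have "(\<Prod>v\<in>I. Poly_Mapping.single (f v) (1::'a)) = Poly_Mapping.single (sum f I) 1"
    for I and f :: "'v \<Rightarrow> 'v \<Rightarrow>\<^sub>0 nat"
    by (induction I rule: infinite_finite_induct) (simp_all add: mult_single)
  then show ?thesis by (simp add: mvar_power sum_single_lookup)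
qed

lemma meval_superset:
  assumes "finite K" "Poly_Mapping.keys p \<subseteq> K" "h 0 = 0"
  shows "meval h \<sigma> p = (\<Sum>m\<in>K. h (Poly_Mapping.lookup p m) *
    (\<Prod>v\<in>Poly_Mapping.keys m. \<sigma> v ^ Poly_Mapping.lookup m v))"
  unfolding meval_def using assms
  by (intro sum.mono_neutral_left) (auto simp: in_keys_iff)

lemma meval_add:
  assumes "\<And>a b. h (a + b) = h a + h b" "h 0 = 0"
  shows "meval h \<sigma> (p + q) = meval h \<sigma> p + meval h \<sigma> q"
  unfolding meval_def
  using setsum_keys_plus_distrib[of "\<lambda>m c. h c * (\<Prod>v\<in>Poly_Mapping.keys m. \<sigma> v ^ Poly_Mapping.lookup m v)" p q]
  by (simp add: assms distrib_right)

lemma meval_mconst_mult: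
  fixes p :: ypoly and \<sigma> :: "nat \<times> nat \<Rightarrow> ypoly"
  shows "meval mconst \<sigma> (mconst c * p) = mconst c * meval mconst \<sigma> p"
proof -
  have "Poly_Mapping.keys (mconst c * p) \<subseteq> Poly_Mapping.keys p"
    by (auto simp: in_keys_iff lookup_mconst_mult)
  from meval_superset[of _ _ mconst \<sigma>, OF finite_keys this mconst_simps(1)] show ?thesis
    by (simp only: meval_def[of _ _ p] lookup_mconst_mult mconst_simps(4) sum_distrib_left mult.assoc)
qed

text \<open>The support is confined to the variables that occur in \<open>Ymat n\<close>, because
  those are the ones that a diagonal matrix rescales in \<open>borel_act\<close>; a variable below
  the diagonal would be sent to 0.\<close>

definition row_homogeneous :: "nat \<Rightarrow> (nat \<Rightarrow> nat) \<Rightarrow> ypoly \<Rightarrow> bool" where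
  "row_homogeneous n a p \<longleftrightarrow> (\<forall>m\<in>Poly_Mapping.keys p.
     Poly_Mapping.keys m \<subseteq> {(i, j). i \<le> j \<and> j < n} \<and>
     (\<forall>i. (\<Sum>j<n. Poly_Mapping.lookup m (i, j)) = a i))"

lemma row_homogeneous_0: "row_homogeneous n a 0"
  by (simp add: row_homogeneous_def)

lemma row_homogeneous_1: "row_homogeneous n (\<lambda>_. 0) 1"
  by (simp add: row_homogeneous_def)

lemma row_homogeneous_mvar:
  "i \<le> j \<Longrightarrow> j < n \<Longrightarrow> row_homogeneous n (\<lambda>k. of_bool (k = i)) (mvar (i, j))"
  by (auto simp: row_homogeneous_def mvar_def lookup_single when_def)

lemma row_homogeneous_uminus: "row_homogeneous n a (- p) \<longleftrightarrow> row_homogeneous n a p"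
  by (simp add: row_homogeneous_def)

lemma row_homogeneous_add:
  "row_homogeneous n a p \<Longrightarrow> row_homogeneous n a q \<Longrightarrow> row_homogeneous n a (p + q)"
  using keys_add[of p q] unfolding row_homogeneous_def by blast

lemma row_homogeneous_sum:
  "(\<And>i. i \<in> I \<Longrightarrow> row_homogeneous n a (f i)) \<Longrightarrow> row_homogeneous n a (\<Sum>i\<in>I. f i)"
  by (induction I rule: infinite_finite_induct) (auto intro: row_homogeneous_add row_homogeneous_0)

lemma row_homogeneous_mult:
  assumes "row_homogeneous n a p" "row_homogeneous n b q"
  shows "row_homogeneous n (\<lambda>i. a i + b i) (p * q)"
  unfolding row_homogeneous_def
proof
  fix m
  assume "m \<in> Poly_Mapping.keys (p * q)"
  then obtain k l where kl: "m = k + l" "k \<in> Poly_Mapping.keys p" "l \<in> Poly_Mapping.keys q"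
    using keys_mult[of p q] by blast
  have "Poly_Mapping.keys m \<subseteq> {(i, j). i \<le> j \<and> j < n}"
    using assms kl keys_add[of k l] unfolding row_homogeneous_def by blast
  moreover have "(\<Sum>j<n. Poly_Mapping.lookup m (i, j)) = a i + b i" for i
    using assms kl unfolding row_homogeneous_def by (simp add: lookup_add sum.distrib)
  ultimately show "Poly_Mapping.keys m \<subseteq> {(i, j). i \<le> j \<and> j < n} \<and>
     (\<forall>i. (\<Sum>j<n. Poly_Mapping.lookup m (i, j)) = a i + b i)" by blast
qed

lemma row_homogeneous_prod:
  "(\<And>k. k \<in> I \<Longrightarrow> row_homogeneous n (a k) (f k)) \<Longrightarrow>
    row_homogeneous n (\<lambda>i. \<Sum>k\<in>I. a k i) (\<Prod>k\<in>I. f k)"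
  by (induction I rule: infinite_finite_induct)
    (simp_all add: row_homogeneous_1 row_homogeneous_mult)

lemma row_homogeneous_unique:
  assumes "row_homogeneous n a p" "row_homogeneous n b p" "p \<noteq> 0"
  shows "a = b"
proof -
  obtain m where "m \<in> Poly_Mapping.keys p" using assms(3) by fastforce
  then show ?thesis using assms(1,2) unfolding row_homogeneous_def by (metis ext)
qed

text \<open>Each term of the permutation expansion takes from every row of \<open>A\<close> one
  entry, a variable of that row or zero, so it is linear in each of these rows.\<close>

lemma row_homogeneous_minor:
  assumes A: "A \<subseteq> {..<n}" "S \<subseteq> {..<n}" "card A = card S"
  shows "row_homogeneous n (\<lambda>i. of_bool (i \<in> A)) (minor n A S)"
proof -
  let ?k = "card A" and ?M = "submatrix (Ymat n) A S"
  have fin: "finite A" using A(1) finite_subset by blast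
  have bij: "bij_betw (pick A) {0..<?k} A"
  proof -
    have "inj_on (pick A) {0..<?k}"
      by (rule linorder_inj_onI') (metis atLeastLessThan_iff less_irrefl pick_mono_le)
    moreover have "pick A ` {0..<?k} \<subseteq> A" using pick_in_set_le by auto
    ultimately show ?thesis
      using card_image[of "pick A" "{0..<?k}"] card_subset_eq[OF fin] by (auto simp: bij_betw_def)
  qed
  have entry: "row_homogeneous n (\<lambda>k. of_bool (k = pick A i)) (?M $$ (i, j))"
    if "i < ?k" "j < ?k" for i j
  proof -
    have "pick S j < n" using pick_in_set_le[of j S] that A by auto
    then show ?thesis
      using that A by (simp add: submatrix_Ymat row_homogeneous_mvar row_homogeneous_0)
  qed
  have row: "(\<Sum>i = 0..<?k. of_bool (k = pick A i)) = (of_bool (k \<in> A) :: nat)" for k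
  proof -
    have "(\<Sum>i = 0..<?k. of_bool (k = pick A i)) = (\<Sum>i\<in>A. of_bool (k = i) :: nat)"
      by (rule sum.reindex_bij_betw[OF bij])
    also have "\<dots> = of_bool (k \<in> A)" using fin by (simp add: of_bool_def)
    finally show ?thesis .
  qed
  have summand: "row_homogeneous n (\<lambda>i. of_bool (i \<in> A)) (signof p * (\<Prod>i = 0..<?k. ?M $$ (i, p i)))"
    if "p permutes {0..<?k}" for p
  proof -
    have "p i < ?k" if "i < ?k" for i
      using permutes_in_image[OF \<open>p permutes _\<close>, of i] that by simp
    then have "row_homogeneous n (\<lambda>k. \<Sum>i = 0..<?k. of_bool (k = pick A i)) (\<Prod>i = 0..<?k. ?M $$ (i, p i))"
      by (intro row_homogeneous_prod entry) auto
    then show ?thesis by (auto simp: row sign_def row_homogeneous_uminus)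
  qed
  have "?M \<in> carrier_mat ?k ?k" using A by (simp add: submatrix_Ymat)
  from det_def'[OF this] show ?thesis
    using row_homogeneous_sum[of "{p. p permutes {0..<?k}}", OF summand] by simp
qed

lemma row_homogeneous_diagram_det:
  assumes "is_diagram n C" "is_diagram n D" "diagram_le n C D"
  shows "row_homogeneous n (\<lambda>i. card {j. (i, j) \<in> C}) (diagram_det n C D)"
proof -
  have "row_homogeneous n (\<lambda>i. \<Sum>j<n. of_bool (i \<in> dcol C j)) (diagram_det n C D)"
    unfolding diagram_det_def using assms dcol_subset
    by (intro row_homogeneous_prod row_homogeneous_minor) (auto simp: diagram_le_def)
  moreover have "(\<Sum>j<n. of_bool (i \<in> dcol C j)) = card {j. (i, j) \<in> C}" for i
  proof -
    have "{..<n} \<inter> {j. i \<in> dcol C j} = {j. (i, j) \<in> C}"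
      using assms(1) by (auto simp: is_diagram_def dcol_def)
    then show ?thesis by (simp add: sum_of_bool_eq)
  qed
  ultimately show ?thesis by simp
qed

text \<open>The inversion in the dual character cancels the one in the action, which leaves
  \<open>x\<close> itself. The value of \<open>mat_inverse\<close> is pinned down by uniqueness of
  inverses.\<close>

lemma mat_inverse_mat_diag:
  fixes x :: "nat \<Rightarrow> 'a::field"
  assumes "\<And>i. i < n \<Longrightarrow> x i \<noteq> 0"
  shows "the (mat_inverse (mat_diag n (\<lambda>i. inverse (x i)))) = mat_diag n x"
proof -
  let ?A = "mat_diag n (\<lambda>i. inverse (x i))"
  have one: "mat_diag n x * ?A = 1\<^sub>m n" "?A * mat_diag n x = 1\<^sub>m n"
    using assms by (auto simp: mat_diag_def[of n "\<lambda>i. x i * inverse (x i)"]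
        mat_diag_def[of n "\<lambda>i. inverse (x i) * x i"])
  have "?A \<in> Units (ring_mat TYPE('a) n ())"
    using one by (auto simp: Units_def ring_mat_def intro!: bexI[of _ "mat_diag n x"])
  then obtain B where B: "mat_inverse ?A = Some B"
    using mat_inverse(1)[OF mat_diag_dim, of n "\<lambda>i. inverse (x i)" "()"]
    by (cases "mat_inverse ?A") auto
  then have "B * ?A = 1\<^sub>m n" "B \<in> carrier_mat n n" using mat_inverse(2)[OF mat_diag_dim B] by auto
  then have "B = B * (?A * mat_diag n x)" using one by simp
  also have "\<dots> = (B * ?A) * mat_diag n x"
    using \<open>B \<in> carrier_mat n n\<close> by (simp add: assoc_mult_mat[of _ n n _ n _ n])
  also have "\<dots> = mat_diag n x" 
    using \<open>B * ?A = 1\<^sub>m n\<close> left_mult_one_mat[OF mat_diag_dim] by simp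
  finally show ?thesis using B by simp
qed

text \<open>The action multiplies each variable of row \<open>i\<close> by \<open>x i\<close>, so
  all monomials with the same row degrees pick up the same factor.\<close>

lemma borel_act_row_homogeneous:
  assumes x: "\<And>i. i < n \<Longrightarrow> x i \<noteq> 0" and p: "row_homogeneous n a p"
  shows "borel_act n (mat_diag n (\<lambda>i. inverse (x i))) p = mconst (\<Prod>i<n. x i ^ a i) * p"
proof -
  define \<sigma> where "\<sigma> = (\<lambda>ij. (map_mat mconst (mat_diag n x) * Ymat n) $$ ij)"
  have *: "map_mat mconst (mat_diag n x) = mat_diag n (\<lambda>i. mconst (x i) :: ypoly)"
    by (rule eq_matI) (auto simp: mat_diag_def mconst_simps)
  have \<sigma>: "\<sigma> (i, j) = mconst (x i) * mvar (i, j)" if "i \<le> j" "j < n" for i j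
  proof -
    have "Ymat n \<in> carrier_mat n n" by (simp add: Ymat_def)
    from mat_diag_mult_left[OF this] show ?thesis using that by (simp add: \<sigma>_def * Ymat_def)
  qed
  have mono: "(\<Prod>v\<in>Poly_Mapping.keys m. \<sigma> v ^ Poly_Mapping.lookup m v) =
      mconst (\<Prod>i<n. x i ^ a i) * Poly_Mapping.single m 1" if m: "m \<in> Poly_Mapping.keys p" for m
  proof -
    have k: "Poly_Mapping.keys m \<subseteq> {(i, j). i \<le> j \<and> j < n}"
      and a: "\<And>i. (\<Sum>j<n. Poly_Mapping.lookup m (i, j)) = a i"
      using p m unfolding row_homogeneous_def by auto
    have "(\<Prod>v\<in>Poly_Mapping.keys m. \<sigma> v ^ Poly_Mapping.lookup m v) =
        (\<Prod>v\<in>Poly_Mapping.keys m. mconst (x (fst v) ^ Poly_Mapping.lookup m v) *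
          mvar v ^ Poly_Mapping.lookup m v)"
      using k by (intro prod.cong) (auto simp: \<sigma> power_mult_distrib mconst_power)
    also have "\<dots> = mconst (\<Prod>v\<in>Poly_Mapping.keys m. x (fst v) ^ Poly_Mapping.lookup m v) *
        Poly_Mapping.single m 1"
      by (simp add: prod.distrib prod_mvar_power mconst_prod)
    also have "(\<Prod>v\<in>Poly_Mapping.keys m. x (fst v) ^ Poly_Mapping.lookup m v) =
        (\<Prod>v\<in>{..<n} \<times> {..<n}. x (fst v) ^ Poly_Mapping.lookup m v)"
      using k by (intro prod.mono_neutral_left) (auto simp: in_keys_iff)
    also have "\<dots> = (\<Prod>i<n. \<Prod>j<n. x i ^ Poly_Mapping.lookup m (i, j))"
      by (simp add: prod.cartesian_product split_beta)
    also have "\<dots> = (\<Prod>i<n. x i ^ a i)" by (simp add: power_sum[symmetric] a)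
    finally show ?thesis .
  qed
  have "borel_act n (mat_diag n (\<lambda>i. inverse (x i))) p = meval mconst \<sigma> p"
    by (simp add: borel_act_def mat_inverse_mat_diag[OF x] \<sigma>_def)
  also have "\<dots> = (\<Sum>m\<in>Poly_Mapping.keys p. mconst (Poly_Mapping.lookup p m) *
      (mconst (\<Prod>i<n. x i ^ a i) * Poly_Mapping.single m 1))"
    unfolding meval_def by (intro sum.cong refl) (simp add: mono)
  also have "\<dots> = mconst (\<Prod>i<n. x i ^ a i) *
      (\<Sum>m\<in>Poly_Mapping.keys p. Poly_Mapping.single m (Poly_Mapping.lookup p m))"
    unfolding sum_distrib_left
    by (intro sum.cong refl) (simp add: mconst_def mult_single mult.commute)
  finally show ?thesis by (simp add: sum_single_lookup)
qed

section \<open>Trace and independence of weight vectors\<close>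

text \<open>\<open>trace_on\<close> works in a basis \<open>B\<close> picked by \<open>SOME\<close>,
  so the trace has to be carried over to \<open>E\<close>: the coordinates \<open>?r\<close> and
  \<open>?s\<close> form mutually inverse changes of basis, and conjugation by them preserves the
  trace.\<close>

lemma trace_on_eigenbasis:
  assumes E: "finite E" "yvs.independent E"
    and add: "\<And>p q. f (p + q) = f p + f q" and scale: "\<And>c p. f (mconst c * p) = mconst c * f p"
    and eig: "\<And>e. e \<in> E \<Longrightarrow> f e = mconst (ev e) * e"
  shows "trace_on (yvs.span E) f = (\<Sum>e\<in>E. ev e)"
proof -
  define B where "B = (SOME B. yvs.independent B \<and> yvs.span B = yvs.span E)"
  have B: "yvs.independent B" "yvs.span B = yvs.span E"
    using someI[of "\<lambda>B. yvs.independent B \<and> yvs.span B = yvs.span E" E] E(2)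
    by (auto simp: B_def)
  \<comment> \<open>An infinite \<open>B\<close> would turn the sum in \<open>trace_on\<close> into
    the default 0.\<close>
  have finB: "finite B"
    using yvs.independent_span_bound[OF E(1) B(1)] B(2) yvs.span_superset by blast
  have EB: "e \<in> yvs.span B" if "e \<in> E" for e using that B(2) yvs.span_base by blast
  have BE: "b \<in> yvs.span E" if "b \<in> B" for b using that B(2) yvs.span_base by blast
  let ?r = "yvs.representation B" and ?s = "yvs.representation E"
  have f0: "f 0 = 0" using add[of 0 0] by simp
  have fsum: "f (\<Sum>e\<in>I. g e) = (\<Sum>e\<in>I. f (g e))" for I and g :: "ypoly \<Rightarrow> ypoly"
    by (induction I rule: infinite_finite_induct) (simp_all add: f0 add)
  have diag: "?r (f b) b = (\<Sum>e\<in>E. ev e * (?r e b * ?s b e))" if "b \<in> B" for b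
  proof -
    have b: "(\<Sum>e\<in>E. mconst (?s b e) * e) = b"
      by (rule yvs.sum_representation_eq[OF E(2) BE[OF that] E(1) order_refl])
    have "f (\<Sum>e\<in>E. mconst (?s b e) * e) = (\<Sum>e\<in>E. f (mconst (?s b e) * e))"
      by (rule fsum)
    also have "\<dots> = (\<Sum>e\<in>E. mconst (?s b e * ev e) * e)"
    proof (rule sum.cong[OF refl])
      fix e
      assume "e \<in> E"
      then show "f (mconst (?s b e) * e) = mconst (?s b e * ev e) * e"
        by (simp only: scale eig mconst_simps(4) mult.assoc)
    qed
    finally have fb: "f b = (\<Sum>e\<in>E. mconst (?s b e * ev e) * e)"
      by (simp only: b)
    have "?r (\<Sum>e\<in>E. mconst (?s b e * ev e) * e) b = (\<Sum>e\<in>E. ?r (mconst (?s b e * ev e) * e) b)"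
      by (simp add: yvs.representation_sum[OF B(1)] EB yvs.span_scale)
    also have "\<dots> = (\<Sum>e\<in>E. ev e * (?r e b * ?s b e))"
      by (intro sum.cong refl) (simp add: yvs.representation_scale[OF B(1) EB])
    finally show ?thesis by (simp only: fb)
  qed
  have one: "(\<Sum>b\<in>B. ?r e b * ?s b e) = 1" if "e \<in> E" for e
  proof -
    have "e = (\<Sum>b\<in>B. mconst (?r e b) * b)"
      using yvs.sum_representation_eq[OF B(1) EB[OF that] finB] by simp
    then have "?s e e = ?s (\<Sum>b\<in>B. mconst (?r e b) * b) e"
      by (rule arg_cong[where f = "\<lambda>v. ?s v e"])
    also have "\<dots> = (\<Sum>b\<in>B. ?s (mconst (?r e b) * b) e)"
      by (simp add: yvs.representation_sum[OF E(2)] BE yvs.span_scale)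
    also have "\<dots> = (\<Sum>b\<in>B. ?r e b * ?s b e)"
      by (intro sum.cong refl) (simp add: yvs.representation_scale[OF E(2) BE])
    finally show ?thesis using yvs.representation_basis[OF E(2) that] by simp
  qed
  have "trace_on (yvs.span E) f = (\<Sum>b\<in>B. \<Sum>e\<in>E. ev e * (?r e b * ?s b e))"
    unfolding trace_on_def Let_def B_def[symmetric] by (intro sum.cong refl diag)
  also have "\<dots> = (\<Sum>e\<in>E. ev e * (\<Sum>b\<in>B. ?r e b * ?s b e))"
    by (subst sum.swap) (simp add: sum_distrib_left)
  also have "\<dots> = (\<Sum>e\<in>E. ev e)" by (simp add: one)
  finally show ?thesis .
qed

text \<open>Polynomials of different row weights share no monomial, so any monomial of
  \<open>e\<close> isolates the coefficient of \<open>e\<close> in a vanishing combination.\<close>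

lemma independent_row_homogeneous:
  assumes E: "finite E" "0 \<notin> E" and hom: "\<And>e. e \<in> E \<Longrightarrow> row_homogeneous n (w e) e"
    and inj: "inj_on w E"
  shows "yvs.independent E"
proof (rule yvs.independent_if_scalars_zero[OF E(1)])
  fix c e
  assume zero: "(\<Sum>e\<in>E. mconst (c e) * e) = 0" and e: "e \<in> E"
  have "e \<noteq> 0" using e E(2) by metis
  then obtain m where m: "m \<in> Poly_Mapping.keys e" by fastforce
  have "Poly_Mapping.lookup e' m = 0" if "e' \<in> E - {e}" for e'
  proof (rule ccontr)
    assume "Poly_Mapping.lookup e' m \<noteq> 0"
    then have m': "m \<in> Poly_Mapping.keys e'" by (simp add: in_keys_iff)
    have "w e' i = w e i" for i
      using hom[of e'] hom[OF e] that m m' unfolding row_homogeneous_def by (metis DiffD1)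
    then have "w e' = w e" by (rule ext)
    then show False using inj that e by (auto dest: inj_onD)
  qed
  then have "(\<Sum>e'\<in>E. c e' * Poly_Mapping.lookup e' m) = c e * Poly_Mapping.lookup e m"
    using E(1) e by (simp add: sum.remove[of E e])
  moreover have "(\<Sum>e'\<in>E. c e' * Poly_Mapping.lookup e' m) = 0"
    using arg_cong[OF zero, of "\<lambda>p. Poly_Mapping.lookup p m"]
    by (simp add: lookup_sum lookup_mconst_mult)
  ultimately show "c e = 0" using m by (simp add: in_keys_iff)
qed

text \<open>Encoded as an exponent vector, so that it can itself be a monomial of the
  character.\<close>

definition row_weight :: "diagram \<Rightarrow> (nat \<Rightarrow>\<^sub>0 nat)" where
  "row_weight C = (\<Sum>v\<in>C. Poly_Mapping.single (fst v) 1)"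

lemma lookup_row_weight:
  assumes "is_diagram n C"
  shows "Poly_Mapping.lookup (row_weight C) i = card {j. (i, j) \<in> C}"
proof -
  have fin: "finite C" using assms finite_subset by (fastforce simp: is_diagram_def)
  have "Poly_Mapping.lookup (row_weight C) i = card (C \<inter> {v. fst v = i})"
    using fin by (simp add: row_weight_def lookup_sum lookup_single when_def sum.If_cases)
  also have "C \<inter> {v. fst v = i} = Pair i ` {j. (i, j) \<in> C}" by force
  also have "card \<dots> = card {j. (i, j) \<in> C}" by (intro card_image) (simp add: inj_on_def)
  finally show ?thesis .
qed

section \<open>The character as a sum of distinct monomials\<close>

theorem theorem1p1:
  fixes n :: nat and D :: diagram
  assumes "is_diagram n D"
    and "multiplicity_free n D"
  shows "\<exists>\<chi> :: (nat, int) mpoly. represents_on_torus n \<chi> (dual_char n D) \<and>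
           (\<forall>a. Poly_Mapping.lookup \<chi> a \<in> {0, 1})"
proof -
  \<comment> \<open>Zero determinants add nothing to the span and would have no well-defined weight,
    so they are left out.\<close>
  define G where "G = {C. is_diagram n C \<and> diagram_le n C D \<and> diagram_det n C D \<noteq> 0}"
  define E where "E = (\<lambda>C. diagram_det n C D) ` G"
  define W where "W = row_weight ` G"
  define \<chi> :: "(nat, int) mpoly" where "\<chi> = (\<Sum>a\<in>W. Poly_Mapping.single a 1)"
  have "G \<subseteq> Pow ({..<n} \<times> {..<n})" by (auto simp: G_def is_diagram_def)
  then have finG: "finite G" by (rule finite_subset) simp
  then have fin: "finite E" "finite W" by (simp_all add: E_def W_def)
  have hom: "row_homogeneous n (Poly_Mapping.lookup (row_weight C)) (diagram_det n C D)"
    if "C \<in> G" for C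
  proof -
    have "Poly_Mapping.lookup (row_weight C) = (\<lambda>i. card {j. (i, j) \<in> C})"
      using that lookup_row_weight by (auto simp: G_def)
    then show ?thesis using row_homogeneous_diagram_det that assms(1) by (simp add: G_def)
  qed
  \<comment> \<open>A nonzero polynomial has only one weight, and conversely
    \<open>diagram_det_eq\<close> applies. So determinants and weights correspond one to one, which
    is why every monomial of \<open>\<chi>\<close> has coefficient 1.\<close>
  have eq_iff: "diagram_det n C D = diagram_det n C' D \<longleftrightarrow> row_weight C = row_weight C'"
    if "C \<in> G" "C' \<in> G" for C C'
  proof
    assume eq: "diagram_det n C D = diagram_det n C' D"
    have "Poly_Mapping.lookup (row_weight C) = Poly_Mapping.lookup (row_weight C')"
    proof (rule row_homogeneous_unique)
      show "row_homogeneous n (Poly_Mapping.lookup (row_weight C)) (diagram_det n C' D)"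
        using hom[OF that(1)] unfolding eq .
      show "row_homogeneous n (Poly_Mapping.lookup (row_weight C')) (diagram_det n C' D)"
        by (rule hom[OF that(2)])
      show "diagram_det n C' D \<noteq> 0" using that(2) unfolding G_def by blast
    qed
    then show "row_weight C = row_weight C'" unfolding poly_mapping_eq_iff .
  next
    assume [simp]: "row_weight C = row_weight C'"
    show "diagram_det n C D = diagram_det n C' D"
      using that lookup_row_weight[of n C] lookup_row_weight[of n C']
      by (intro diagram_det_eq[OF assms]) (simp_all add: G_def)
  qed
  \<comment> \<open>\<open>SOME\<close> picks any diagram with this determinant; by
    \<open>eq_iff\<close> they all have the same weight.\<close>
  define wt where "wt e = row_weight (SOME C. C \<in> G \<and> diagram_det n C D = e)" for e
  have wt: "wt (diagram_det n C D) = row_weight C" if "C \<in> G" for C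
    using someI[of "\<lambda>C'. C' \<in> G \<and> diagram_det n C' D = diagram_det n C D" C] that
    unfolding wt_def using eq_iff that by blast
  have inj: "inj_on wt E" using eq_iff wt by (auto simp: E_def inj_on_def)
  have img: "wt ` E = W" unfolding E_def W_def image_image by (intro image_cong refl wt)
  have homE: "row_homogeneous n (Poly_Mapping.lookup (wt e)) e" if "e \<in> E" for e
    using that hom wt by (auto simp: E_def)
  have indep: "yvs.independent E"
  proof (rule independent_row_homogeneous[OF fin(1) _ homE])
    show "0 \<notin> E"
    proof
      assume "0 \<in> E"
      then obtain C where "C \<in> G" "diagram_det n C D = 0" unfolding E_def by (metis imageE)
      then show False unfolding G_def by blast
    qed
    show "inj_on (\<lambda>e. Poly_Mapping.lookup (wt e)) E"
      using inj unfolding inj_on_def poly_mapping_eq_iff .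
  qed
  have "flagged_weyl n D = yvs.span E"
  proof -
    have "{diagram_det n C D | C. is_diagram n C \<and> diagram_le n C D} - {0} = E" (is "?X - {0} = E")
    proof (rule subset_antisym)
      show "?X - {0} \<subseteq> E"
      proof
        fix e
        assume e: "e \<in> ?X - {0}"
        then obtain C where C: "e = diagram_det n C D" "is_diagram n C" "diagram_le n C D" by blast
        then have "C \<in> G" using e unfolding G_def by simp
        then show "e \<in> E" unfolding E_def C(1) by (rule imageI)
      qed
      show "E \<subseteq> ?X - {0}" unfolding E_def by (rule image_subsetI) (simp add: G_def, blast)
    qed
    from arg_cong[OF this, of yvs.span] show ?thesis
      unfolding flagged_weyl_def yvs.span_delete_0 .
  qed
  have keys_W: "Poly_Mapping.keys a \<subseteq> {..<n}" if "a \<in> W" for a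
  proof -
    obtain C where "a = row_weight C" "is_diagram n C" using \<open>a \<in> W\<close> by (auto simp: W_def G_def)
    moreover have "{j. (i, j) \<in> C} = {}" if "\<not> i < n" for i
      using that \<open>is_diagram n C\<close> by (auto simp: is_diagram_def)
    ultimately show ?thesis by (fastforce simp: in_keys_iff lookup_row_weight)
  qed
  have lookup: "Poly_Mapping.lookup \<chi> a = of_bool (a \<in> W)" for a
    using fin(2) by (simp add: \<chi>_def lookup_sum lookup_single when_def of_bool_def)
  then have keys: "Poly_Mapping.keys \<chi> = W" by (auto simp: in_keys_iff)
  have "dual_char n D x = meval of_int x \<chi>" if x: "\<forall>i<n. x i \<noteq> 0" for x
  proof -
    have "dual_char n D x = (\<Sum>e\<in>E. \<Prod>i<n. x i ^ Poly_Mapping.lookup (wt e) i)"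
      unfolding dual_char_def weyl_char_def \<open>flagged_weyl n D = yvs.span E\<close>
    proof (rule trace_on_eigenbasis[OF fin(1) indep])
      show "borel_act n (mat_diag n (\<lambda>i. inverse (x i))) e =
          mconst (\<Prod>i<n. x i ^ Poly_Mapping.lookup (wt e) i) * e" if "e \<in> E" for e
        using x borel_act_row_homogeneous[OF _ homE[OF that]] by blast
    qed (simp_all add: borel_act_def meval_add meval_mconst_mult mconst_simps)
    also have "\<dots> = (\<Sum>a\<in>W. \<Prod>i<n. x i ^ Poly_Mapping.lookup a i)"
      unfolding img[symmetric] by (simp add: sum.reindex[OF inj])
    also have "\<dots> = meval of_int x \<chi>"
      unfolding meval_def keys
    proof (rule sum.cong[OF refl])
      fix a
      assume "a \<in> W"
      have "(\<Prod>i<n. x i ^ Poly_Mapping.lookup a i) =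
          (\<Prod>i\<in>Poly_Mapping.keys a. x i ^ Poly_Mapping.lookup a i)"
        using keys_W[OF \<open>a \<in> W\<close>] by (intro prod.mono_neutral_right) (auto simp: in_keys_iff)
      then show "(\<Prod>i<n. x i ^ Poly_Mapping.lookup a i) = of_int (Poly_Mapping.lookup \<chi> a) *
          (\<Prod>i\<in>Poly_Mapping.keys a. x i ^ Poly_Mapping.lookup a i)"
        using \<open>a \<in> W\<close> by (simp add: lookup)
    qed
    finally show ?thesis .
  qed
  then have "represents_on_torus n \<chi> (dual_char n D)"
    using keys_W by (auto simp: represents_on_torus_def mvars_def keys)
  then show ?thesis using lookup by (intro exI[of _ \<chi>]) (auto simp: of_bool_def)
qed

end
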